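(* In the state-dependent-gain setting described in the context, assume $\tilde\Gamma>0$, $\Delta<0$ and $\mu_0\in(\mu_{\mathrm{SN}},0)$. Let $(r^\star,\theta_0)$, $r^\star>0$, be a locally stable committed equilibrium. Then there exists $\delta^\star>0$ such that, if $$\big|[\Psi_A(\delta\boldsymbol b_i)]^\top\boldsymbol e_{\theta_0}\big|<\delta^\star$$ in the destabilizing direction, transient fluctuations $\delta\boldsymbol b_i(t)$ of the evidence do not destroy finite-amplitude commitment (the finite-amplitude committed branch of the radial equation persists). If this projected input exceeds the saddle-node threshold, the committed branch is lost and the state undergoes a finite-amplitude jump. The selected action persists provided the resulting phase remains in the same action-selection sector; otherwise, the angular equation $g_\theta=0$ determines the reallocated action.
   Context: Base dynamics: $\tau_z\dot{\boldsymbol z}_i=-d_z\boldsymbol z_i+S(\alpha A\boldsymbol z_i+\boldsymbol b_i)$ on $\mathbb R^K$, with $\tau_z,d_z>0$, $S$ odd, $\mathcal C^3$, sigmoidal, componentwise, $S'(0)=1$, $s_3:=S'''(0)\neq0$, and $\boldsymbol b_i$ the evidence of agent $i$. $A$ is real, symmetric, circulant with eigenvectors $\boldsymbol\phi_k=(\cos(k\theta_j))_j$, $\boldsymbol\psi_k=(\sin(k\theta_j))_j$, $\theta_j=2\pi j/K$, and eigenvalues $\lambda_k$; there is a unique $k_\star$ with $\lambda_{k_\star}>\lambda_k$ for $k\ne k_\star$, with $\lambda_{k_\star}>0$ and $0<k_\star<K/2$. $E_c=\mathrm{span}\{\boldsymbol\phi_{k_\star},\boldsymbol\psi_{k_\star}\}$,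 $\Psi_A$ is the orthogonal projection onto $E_c$ with respect to $\langle \boldsymbol u,\boldsymbol v\rangle=\frac1K\sum_ju_jv_j$, and $\boldsymbol e_\theta=\sqrt2(\cos\theta\,\boldsymbol\phi_{k_\star}+\sin\theta\,\boldsymbol\psi_{k_\star})$; a point of $E_c$ is written $r\boldsymbol e_\theta$. Writing $b_j=a_0+\sum_m(a_m\cos(m\theta_j)+\beta_m\sin(m\theta_j))$, set $A^b_m=\sqrt{a_m^2+\beta_m^2}$ and $\theta^b_m=\operatorname{atan2}(\beta_m,a_m)$. The notation $[\Psi_A(\boldsymbol b)]^\top\boldsymbol e_\theta$ means $\langle\Psi_A(\boldsymbol b),\boldsymbol e_\theta\rangle=\frac{A^b_{k_\star}}{\sqrt2}\cos(\theta-\theta^b_{k_\star})$. State-dependent gain: $\alpha=\alpha_0+\kappa\|\boldsymbol z\|^2$. With $\mu_0=-d_z+\alpha_0\lambda_{k_\star}$, $\alpha_c=d_z/\lambda_{k_\star}$, $\Gamma=\frac{s_3}{4}\alpha_c^3\lambda_{k_\star}^3$ and $\tilde\Gamma=\Gamma+\kappa\lambda_{k_\star}$, the reduced radial equation on $E_c$ is $$g_r=\mu_0r+\tilde\Gamma r^3+\Delta r^5+[\Psi_A(\boldsymbol b)]^\top\boldsymbol e_\theta=0,$$ where $\Delta$ is the coefficient of the quintic term. The angular equation is $g_\theta=0$ with $$g_\theta=\tfrac{A_{k_\star}^b}{\sqrt{2}}\sin(\theta_{k_\star}^b - \theta)+ \tfrac{\eta r^2}{\sqrt{2}}\big[3A_{k_\star}^b\sin(\theta_{k_\star}^b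 - \theta)+ A_{3k_\star}^b\sin(\theta_{3k_\star}^b - 3\theta)\big],\quad \eta=\tfrac{s_3}{4}\alpha_c^2\lambda_{k_\star}^2$$ (for $\boldsymbol b\ne\boldsymbol 0$; $g_\theta\equiv0$ for $\boldsymbol b=\boldsymbol 0$). $\mu_{\mathrm{SN}}<0$ is the saddle-node value of $\mu_0$ for the unforced ($\boldsymbol b=\boldsymbol 0$) radial equation, i.e. the value at which $g_r=0$ and $\partial_rg_r=0$ have a common solution $r>0$. For $\mu_0\in(\mu_{\mathrm{SN}},0)$ the unforced radial equation has the stable solution $r=0$, a stable committed solution $r^\star>0$, and an unstable solution between them. Committed equilibrium: an equilibrium with finite amplitude $r^\star>0$ on the stable upper branch. Perturbing the evidence by $\delta\boldsymbol b_i$ adds $[\Psi_A(\delta\boldsymbol b_i)]^\top\boldsymbol e_{\theta_0}$ to the radial equation along $\boldsymbol e_{\theta_0}$; the destabilizing direction is the sign (negative) that decreases the committed amplitude. The saddle-node threshold is the magnitude of this input at which the committed solution merges with the unstable one and disappears. The selected action at phase $\theta$ is the index of the largest entry of $\boldsymbol e_\theta$, and the action-selection sector of an action is the set of phases selecting it. *)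

theory Defs
  imports "HOL-Analysis.Analysis"
begin

text \<open>Vectors of \<open>\<real>\<^sup>K\<close> and \<open>K \<times> K\<close> matrices are functions on \<^typ>\<open>nat\<close> of which only
  the values at indices below \<open>K\<close> matter.\<close>

record decision_system =
  dimK :: nat
  tau_z :: real
  d_z :: real
  act :: "real \<Rightarrow> real"            (* S *)
  adj :: "nat \<Rightarrow> nat \<Rightarrow> real"     (* A *)
  eigval :: "nat \<Rightarrow> real"          (* lambda *)
  kstar :: nat
  alpha0 :: real
  kappa :: real
  quintic :: real                  (* Delta *)

subsection \<open>Ring geometry and standing assumptions\<close>

definition ring_angle :: "nat \<Rightarrow> nat \<Rightarrow> real" where
  "ring_angle K j = 2 * pi * real j / real K"

definition cos_mode :: "nat \<Rightarrow> nat \<Rightarrow> nat \<Rightarrow> real" where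
  "cos_mode K k j = cos (real k * ring_angle K j)"

definition sin_mode :: "nat \<Rightarrow> nat \<Rightarrow> nat \<Rightarrow> real" where
  "sin_mode K k j = sin (real k * ring_angle K j)"

definition C3 :: "(real \<Rightarrow> real) \<Rightarrow> bool" where
  "C3 f \<longleftrightarrow> (\<forall>n<3. \<forall>x. (deriv ^^ n) f differentiable (at x)) \<and>
           continuous_on UNIV ((deriv ^^ 3) f)"

definition sigmoidal :: "(real \<Rightarrow> real) \<Rightarrow> bool" where
  "sigmoidal f \<longleftrightarrow> strict_mono f \<and> bounded (range f)"

definition admissible_activation :: "(real \<Rightarrow> real) \<Rightarrow> bool" where
  "admissible_activation f \<longleftrightarrow>
     (\<forall>x. f (- x) = - f x) \<and> C3 f \<and> sigmoidal f \<and> deriv f 0 = 1 \<and> (deriv ^^ 3) f 0 \<noteq> 0"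

definition circulant :: "nat \<Rightarrow> (nat \<Rightarrow> nat \<Rightarrow> real) \<Rightarrow> bool" where
  "circulant K M \<longleftrightarrow> (\<forall>i<K. \<forall>j<K. M (Suc i mod K) (Suc j mod K) = M i j)"

definition eigenvector_at :: "nat \<Rightarrow> (nat \<Rightarrow> nat \<Rightarrow> real) \<Rightarrow> real \<Rightarrow> (nat \<Rightarrow> real) \<Rightarrow> bool" where
  "eigenvector_at K M l v \<longleftrightarrow> (\<forall>i<K. (\<Sum>j<K. M i j * v j) = l * v i)"

text \<open>Wave numbers \<open>k\<close> and \<open>K - k\<close> give the same mode pair, so the distinct ones are those with
  \<open>2 * k \<le> K\<close>.  Where \<^const>\<open>sin_mode\<close> vanishes identically its eigenvector equation is void.\<close>

definition standing_assumptions :: "decision_system \<Rightarrow> bool" where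
  "standing_assumptions P \<longleftrightarrow>
     0 < tau_z P \<and> 0 < d_z P \<and> admissible_activation (act P) \<and>
     (\<forall>i<dimK P. \<forall>j<dimK P. adj P i j = adj P j i) \<and> circulant (dimK P) (adj P) \<and>
     (\<forall>k. 2 * k \<le> dimK P \<longrightarrow>
        eigenvector_at (dimK P) (adj P) (eigval P k) (cos_mode (dimK P) k) \<and>
        eigenvector_at (dimK P) (adj P) (eigval P k) (sin_mode (dimK P) k)) \<and>
     0 < kstar P \<and> 2 * kstar P < dimK P \<and> 0 < eigval P (kstar P) \<and>
     (\<forall>k. 2 * k \<le> dimK P \<and> k \<noteq> kstar P \<longrightarrow> eigval P k < eigval P (kstar P))"

subsection \<open>The critical plane and the evidence\<close>

definition ip :: "decision_system \<Rightarrow> (nat \<Rightarrow> real) \<Rightarrow> (nat \<Rightarrow> real) \<Rightarrow> real" where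
  "ip P u v = (1 / real (dimK P)) * (\<Sum>j<dimK P. u j * v j)"

definition E_c :: "decision_system \<Rightarrow> (nat \<Rightarrow> real) set" where
  "E_c P = {(\<lambda>j. x * cos_mode (dimK P) (kstar P) j + y * sin_mode (dimK P) (kstar P) j) | x y. True}"

definition Psi_A :: "decision_system \<Rightarrow> (nat \<Rightarrow> real) \<Rightarrow> nat \<Rightarrow> real" where
  "Psi_A P b = (THE p. p \<in> E_c P \<and> (\<forall>v\<in>E_c P. ip P (\<lambda>j. b j - p j) v = 0))"

definition e_dir :: "decision_system \<Rightarrow> real \<Rightarrow> nat \<Rightarrow> real" where
  "e_dir P \<theta> j = sqrt 2 * (cos \<theta> * cos_mode (dimK P) (kstar P) j
                         + sin \<theta> * sin_mode (dimK P) (kstar P) j)"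

definition proj_input :: "decision_system \<Rightarrow> (nat \<Rightarrow> real) \<Rightarrow> real \<Rightarrow> real" where
  "proj_input P b \<theta> = ip P (Psi_A P b) (e_dir P \<theta>)"

text \<open>For \<open>0 < m < K/2\<close> these are the coefficients in the real Fourier expansion of \<open>b\<close>.  The same
  sums for \<open>m \<ge> K/2\<close> (possible for \<open>m = 3 * kstar\<close>) are the aliased coefficients.\<close>

definition fourier_cos :: "decision_system \<Rightarrow> (nat \<Rightarrow> real) \<Rightarrow> nat \<Rightarrow> real" where
  "fourier_cos P b m = 2 * ip P b (cos_mode (dimK P) m)"

definition fourier_sin :: "decision_system \<Rightarrow> (nat \<Rightarrow> real) \<Rightarrow> nat \<Rightarrow> real" where
  "fourier_sin P b m = 2 * ip P b (sin_mode (dimK P) m)"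

definition evid_amp :: "decision_system \<Rightarrow> (nat \<Rightarrow> real) \<Rightarrow> nat \<Rightarrow> real" where
  "evid_amp P b m = sqrt ((fourier_cos P b m)\<^sup>2 + (fourier_sin P b m)\<^sup>2)"

text \<open>\<open>Arg (Complex x y)\<close> is \<open>atan2 y x\<close>.\<close>

definition evid_phase :: "decision_system \<Rightarrow> (nat \<Rightarrow> real) \<Rightarrow> nat \<Rightarrow> real" where
  "evid_phase P b m = Arg (Complex (fourier_cos P b m) (fourier_sin P b m))"

subsection \<open>Reduced radial and angular equations\<close>

definition s3 :: "decision_system \<Rightarrow> real" where
  "s3 P = (deriv ^^ 3) (act P) 0"

definition mu0 :: "decision_system \<Rightarrow> real" where
  "mu0 P = - d_z P + alpha0 P * eigval P (kstar P)"

definition alpha_c :: "decision_system \<Rightarrow> real" where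
  "alpha_c P = d_z P / eigval P (kstar P)"

definition cubic_base :: "decision_system \<Rightarrow> real" where
  "cubic_base P = s3 P / 4 * alpha_c P ^ 3 * eigval P (kstar P) ^ 3"

definition cubic :: "decision_system \<Rightarrow> real" where
  "cubic P = cubic_base P + kappa P * eigval P (kstar P)"

definition eta :: "decision_system \<Rightarrow> real" where
  "eta P = s3 P / 4 * alpha_c P ^ 2 * eigval P (kstar P) ^ 2"

definition unforced_radial :: "decision_system \<Rightarrow> real \<Rightarrow> real \<Rightarrow> real" where
  "unforced_radial P \<mu> r = \<mu> * r + cubic P * r ^ 3 + quintic P * r ^ 5"

definition g_r :: "decision_system \<Rightarrow> (nat \<Rightarrow> real) \<Rightarrow> real \<Rightarrow> real \<Rightarrow> real" where
  "g_r P b r \<theta> = unforced_radial P (mu0 P) r + proj_input P b \<theta>"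

definition g_theta :: "decision_system \<Rightarrow> (nat \<Rightarrow> real) \<Rightarrow> real \<Rightarrow> real \<Rightarrow> real" where
  "g_theta P b r \<theta> =
     evid_amp P b (kstar P) / sqrt 2 * sin (evid_phase P b (kstar P) - \<theta>)
     + eta P * r\<^sup>2 / sqrt 2 *
         (3 * evid_amp P b (kstar P) * sin (evid_phase P b (kstar P) - \<theta>)
          + evid_amp P b (3 * kstar P) * sin (evid_phase P b (3 * kstar P) - 3 * \<theta>))"

definition mu_SN :: "decision_system \<Rightarrow> real" where
  "mu_SN P = (THE \<mu>. \<exists>r>0. unforced_radial P \<mu> r = 0 \<and> deriv (unforced_radial P \<mu>) r = 0)"

subsection \<open>Reduced dynamics\<close>

text \<open>The amplitude is signed: \<open>(- r, \<theta>)\<close> and \<open>(r, \<theta> + \<pi>)\<close> are the same point of the critical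
  plane, and both equations below are invariant under this identification.  The factor \<open>r\<close> in
  front of the phase velocity is the one of the tangential velocity in polar coordinates.\<close>

definition reduced_solution ::
  "decision_system \<Rightarrow> (real \<Rightarrow> nat \<Rightarrow> real) \<Rightarrow> (real \<Rightarrow> real) \<Rightarrow> (real \<Rightarrow> real) \<Rightarrow> bool" where
  "reduced_solution P b r \<theta> \<longleftrightarrow>
     (\<forall>t\<ge>0. \<exists>r' \<theta>'.
        (r has_real_derivative r') (at t within {0..}) \<and>
        (\<theta> has_real_derivative \<theta>') (at t within {0..}) \<and>
        tau_z P * r' = g_r P (b t) (r t) (\<theta> t) \<and>
        tau_z P * r t * \<theta>' = g_theta P (b t) (r t) (\<theta> t))"

definition radial_solution ::
  "decision_system \<Rightarrow> (real \<Rightarrow> real \<Rightarrow> real) \<Rightarrow> (real \<Rightarrow> real) \<Rightarrow> bool" where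
  "radial_solution P F r \<longleftrightarrow>
     (\<forall>t\<ge>0. (r has_real_derivative (F t (r t) / tau_z P)) (at t within {0..}))"

text \<open>Lyapunov (not asymptotic) stability: for \<open>b = 0\<close> the equilibria form a circle.\<close>

definition locally_stable :: "decision_system \<Rightarrow> (nat \<Rightarrow> real) \<Rightarrow> real \<Rightarrow> real \<Rightarrow> bool" where
  "locally_stable P b rs \<theta>s \<longleftrightarrow>
     (\<forall>\<epsilon>>0. \<exists>\<delta>>0. \<forall>r \<theta>. reduced_solution P (\<lambda>_. b) r \<theta> \<and> \<bar>r 0 - rs\<bar> < \<delta> \<and> \<bar>\<theta> 0 - \<theta>s\<bar> < \<delta> \<longrightarrow>
        (\<forall>t\<ge>0. \<bar>r t - rs\<bar> < \<epsilon> \<and> \<bar>\<theta> t - \<theta>s\<bar> < \<epsilon>))"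

subsection \<open>Commitment and its loss\<close>

text \<open>\<open>G\<close> is the right-hand side of a radial equation at a fixed phase.  Being the largest solution
  separates the upper branch from a stable low-amplitude solution created by evidence.\<close>

definition on_upper_branch :: "(real \<Rightarrow> real) \<Rightarrow> real \<Rightarrow> bool" where
  "on_upper_branch G r \<longleftrightarrow> 0 < r \<and> G r = 0 \<and> deriv G r < 0 \<and> (\<forall>r'. G r' = 0 \<longrightarrow> r' \<le> r)"

definition unstable_amplitude :: "(real \<Rightarrow> real) \<Rightarrow> real \<Rightarrow> bool" where
  "unstable_amplitude G r \<longleftrightarrow> 0 < r \<and> G r = 0 \<and> deriv G r > 0"

definition committed_equilibrium :: "decision_system \<Rightarrow> (nat \<Rightarrow> real) \<Rightarrow> real \<Rightarrow> real \<Rightarrow> bool" where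
  "committed_equilibrium P b r \<theta> \<longleftrightarrow>
     on_upper_branch (\<lambda>x. g_r P b x \<theta>) r \<and> g_theta P b r \<theta> = 0"

text \<open>As the destabilizing input \<open>s\<close> grows from \<open>0\<close>, the committed solution \<open>rc\<close> starting at \<open>rs\<close>
  meets an unstable solution \<open>ru\<close> at \<open>s = \<delta>\<close>, and just beyond there is no committed solution.  The
  unstable solution is only required from some \<open>s0\<close> on: strong evidence can make the radial
  equation monostable at \<open>s = 0\<close>.\<close>

definition saddle_node_threshold :: "(real \<Rightarrow> real) \<Rightarrow> real \<Rightarrow> real \<Rightarrow> bool" where
  "saddle_node_threshold G rs \<delta> \<longleftrightarrow> 0 < \<delta> \<and>
     (\<exists>rc ru s0. rc 0 = rs \<and> continuous_on {0..\<delta>} rc \<and>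
        (\<forall>s\<in>{0..<\<delta>}. on_upper_branch (\<lambda>r. G r - s) (rc s)) \<and>
        0 \<le> s0 \<and> s0 < \<delta> \<and> continuous_on {s0..\<delta>} ru \<and>
        (\<forall>s\<in>{s0..<\<delta>}. unstable_amplitude (\<lambda>r. G r - s) (ru s) \<and> ru s < rc s) \<and>
        rc \<delta> = ru \<delta>) \<and>
     (\<forall>\<^sub>F s in at_right \<delta>. \<not> (\<exists>r. on_upper_branch (\<lambda>r. G r - s) r))"

subsection \<open>Action selection\<close>

text \<open>Ties (on sector boundaries, and systematically if \<open>kstar\<close> and \<open>K\<close> are not coprime) are
  broken in favour of the smallest index.\<close>

definition selected_action :: "decision_system \<Rightarrow> real \<Rightarrow> nat" where
  "selected_action P \<theta> = (LEAST j. j < dimK P \<and> (\<forall>i<dimK P. e_dir P \<theta> i \<le> e_dir P \<theta> j))"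

definition action_sector :: "decision_system \<Rightarrow> nat \<Rightarrow> real set" where
  "action_sector P a = {\<theta>. selected_action P \<theta> = a}"

definition phase_of :: "real \<Rightarrow> real \<Rightarrow> real" where
  "phase_of r \<theta> = (if r > 0 then \<theta> else \<theta> + pi)"

end

theory Submission
  imports Defs
begin

text \<open>At a fixed phase the radial field is \<open>f r + a\<close> with \<open>f\<close> the odd unforced quintic and
  \<open>a\<close> the projected evidence, so evidence only translates the graph of \<open>f\<close>.  For \<open>\<mu>\<close> between the
  saddle-node value and \<open>0\<close>, \<open>f\<close> decreases, increases and decreases again on the positive axis, with
  turning points at a lower and an upper fold, and \<open>f\<close> is positive at the upper one, where it is
  maximal.  The committed branch is the inverse of \<open>f\<close> beyond the upper fold; it is met by the inverse
  on the middle interval exactly when the destabilizing input equals the value of the radial field at the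
  upper fold.  Below that value the upper fold is a barrier for the radial flow; above it no positive
  equilibrium is left, the amplitude falls to a negative one, and so the jump has at least the size of the
  upper fold.  A limit of the phase must be a zero of the angular field, since otherwise the phase
  velocity would have a nonzero limit.\<close>

subsection \<open>Barriers for scalar flows\<close>

text \<open>At the last time in \<open>{t0..t}\<close> with \<open>a \<le> r\<close>, the path sits
  exactly on the level, because it falls below it later. The positive derivative there lifts it
  above \<open>a\<close> just afterwards, so that time was not the last.\<close>

lemma stays_above_barrier:
  fixes r D :: "real \<Rightarrow> real"
  assumes der: "\<And>t. t0 \<le> t \<Longrightarrow> (r has_real_derivative D t) (at t within {t0..})"
    and pos: "\<And>t. t0 \<le> t \<Longrightarrow> r t = a \<Longrightarrow> 0 < D t"
    and start: "a \<le> r t0" and t: "t0 \<le> t"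
  shows "a \<le> r t"
proof (rule ccontr)
  assume "\<not> a \<le> r t"
  then have lt: "r t < a" by simp
  have cont: "continuous_on {t0..} r"
    by (rule DERIV_continuous_on) (use der in auto)
  have cont': "continuous_on {t0..t} r"
    by (rule continuous_on_subset[OF cont]) auto
  define S where "S = {t0..t} \<inter> r -` {a..}"
  have "closed S"
    unfolding S_def by (rule continuous_closed_preimage[OF cont']) auto
  moreover have "bounded S"
    unfolding S_def by (rule bounded_subset[of "{t0..t}"]) auto
  ultimately have "compact S" by (simp add: compact_eq_bounded_closed)
  moreover have "S \<noteq> {}" using start t by (auto simp: S_def)
  ultimately obtain s where s: "s \<in> S" "\<forall>u\<in>S. u \<le> s"
    using compact_attains_sup[of S] by blast
  have s': "t0 \<le> s" "s \<le> t" "a \<le> r s" using s(1) by (auto simp: S_def)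
  then have "s < t" using lt by (cases "s = t") auto
  \<comment> \<open>Any crossing after \<open>s\<close> belongs to \<open>S\<close>, so it must
    coincide with its maximum \<open>s\<close>; this pins \<open>r s\<close> to
    \<open>a\<close>.\<close>
  obtain u where u: "s \<le> u" "u \<le> t" "r u = a"
    using IVT2'[OF less_imp_le[OF lt] s'(3,2) continuous_on_subset[OF cont']] s'(1) by auto
  then have "u \<in> S" using s' by (simp add: S_def)
  then have "u = s" using s(2) u(1) by force
  then have "r s = a" using u(3) by simp
  then have "0 < D s" using pos s' by blast
  from has_real_derivative_pos_inc_right[OF der[OF s'(1)] this]
  obtain d where d: "d > 0" "\<And>h. 0 < h \<Longrightarrow> s + h \<in> {t0..} \<Longrightarrow> h < d \<Longrightarrow> r s < r (s + h)"
    by blast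
  define h where "h = min (d / 2) (t - s)"
  have h: "0 < h" "h < d" "s + h \<le> t" using d(1) \<open>s < t\<close> by (auto simp: h_def)
  then have "s + h \<in> S"
    using d(2)[of h] s'(1,3) by (simp add: S_def)
  then show False using s(2) h by force
qed

text \<open>Once the level has been reached it acts as a barrier. If it were never reached, the path
  would climb at rate at least \<open>c\<close> for ever.\<close>

lemma eventually_above_level:
  fixes r D :: "real \<Rightarrow> real"
  assumes der: "\<And>t. t0 \<le> t \<Longrightarrow> (r has_real_derivative D t) (at t within {t0..})"
    and ge: "\<And>t. t0 \<le> t \<Longrightarrow> r t \<le> a \<Longrightarrow> c \<le> D t" and c: "0 < c"
  shows "\<forall>\<^sub>F t in at_top. a \<le> r t"
proof (cases "\<exists>t1\<ge>t0. a \<le> r t1")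
  case True
  then obtain t1 where t1: "t0 \<le> t1" "a \<le> r t1" by blast
  have "a \<le> r t" if "t1 \<le> t" for t
  proof (rule stays_above_barrier[where r = r and D = D, OF _ _ t1(2) that])
    show "(r has_real_derivative D u) (at u within {t1..})" if "t1 \<le> u" for u
      by (rule has_field_derivative_subset[OF der]) (use t1 that in auto)
    show "0 < D u" if "t1 \<le> u" "r u = a" for u
      using ge[of u] that t1 c by auto
  qed
  then show ?thesis unfolding eventually_at_top_linorder by blast
next
  case False
  \<comment> \<open>By this time growth at rate \<open>c\<close> from \<open>r t0\<close> has
    reached \<open>a\<close>.\<close>
  define t1 where "t1 = t0 + (a - r t0) / c"
  have below: "r t < a" if "t0 \<le> t" for t using False that by (meson not_le)
  have lt: "r t0 < a" using below by simp
  then have t1: "t0 < t1" using c by (simp add: t1_def)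
  have cont: "continuous_on {t0..t1} r"
    by (rule continuous_on_subset[of "{t0..}"], rule DERIV_continuous_on) (use der in auto)
  have "\<exists>x>t0. x < t1 \<and> r t1 - r t0 = (t1 - t0) * D x"
  proof -
    have "\<exists>l z. t0 < z \<and> z < t1 \<and> DERIV r z :> l \<and> r t1 - r t0 = (t1 - t0) * l"
    proof (rule MVT[OF t1 cont])
      fix x assume "t0 < x" "x < t1"
      then show "r differentiable (at x)"
        using der[of x] at_within_interior[of x "{t0..}"]
        by (auto simp: real_differentiable_def)
    qed
    then obtain l z where lz: "t0 < z" "z < t1" "DERIV r z :> l" "r t1 - r t0 = (t1 - t0) * l" by blast
    have "DERIV r z :> D z"
      using der[of z] at_within_interior[of z "{t0..}"] lz by auto
    then have "l = D z" using DERIV_unique lz(3) by blast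
    then show ?thesis using lz by blast
  qed
  then obtain x where x: "x > t0" "r t1 - r t0 = (t1 - t0) * D x" by blast
  have "r x \<le> a" using below[of x] x(1) by simp
  then have "c \<le> D x" using ge x(1) by simp
  then have "(t1 - t0) * c \<le> r t1 - r t0" using x(2) t1 by simp
  then have "a \<le> r t1" using c by (simp add: t1_def)
  then show ?thesis using below[of t1] t1 by simp
qed

lemma eventually_below_level:
  fixes r D :: "real \<Rightarrow> real"
  assumes der: "\<And>t. t0 \<le> t \<Longrightarrow> (r has_real_derivative D t) (at t within {t0..})"
    and le: "\<And>t. t0 \<le> t \<Longrightarrow> a \<le> r t \<Longrightarrow> D t \<le> - c" and c: "0 < c"
  shows "\<forall>\<^sub>F t in at_top. r t \<le> a"
proof -
  have "\<forall>\<^sub>F t in at_top. - a \<le> - r t"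
  proof (rule eventually_above_level[OF _ _ c])
    show "((\<lambda>t. - r t) has_real_derivative - D t) (at t within {t0..})" if "t0 \<le> t" for t
      using der[OF that] by (rule DERIV_minus)
    show "c \<le> - D t" if "t0 \<le> t" "- r t \<le> - a" for t
      using le[of t] that by simp
  qed
  then show ?thesis by simp
qed

text \<open>A positive limit of the derivative would carry \<open>u\<close> above
  \<open>l + 1\<close>, against convergence to \<open>l\<close>.\<close>

lemma deriv_limit_zero:
  fixes u D :: "real \<Rightarrow> real"
  assumes der: "\<And>t. t0 \<le> t \<Longrightarrow> (u has_real_derivative D t) (at t within {t0..})"
    and D: "(D \<longlongrightarrow> L) at_top" and u: "(u \<longlongrightarrow> l) at_top"
  shows "L = 0"
proof -
  \<comment> \<open>Stated for arbitrary functions, so that it applies to \<open>u\<close> and to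
    \<open>- u\<close> and excludes both signs of \<open>L\<close>.\<close>
  have not_pos: "\<not> 0 < L"
    if der: "\<And>t. t0 \<le> t \<Longrightarrow> (u has_real_derivative D t) (at t within {t0..})"
      and D: "(D \<longlongrightarrow> L) at_top" and u: "(u \<longlongrightarrow> l) at_top"
    for u D :: "real \<Rightarrow> real" and L l
  proof
    assume L: "0 < L"
    then have "\<forall>\<^sub>F t in at_top. L / 2 < D t" using order_tendstoD(1)[OF D, of "L / 2"] by simp
    then obtain t1 where t1: "\<And>t. t1 \<le> t \<Longrightarrow> L / 2 < D t"
      by (auto simp: eventually_at_top_linorder)
    have "\<forall>\<^sub>F t in at_top. l + 1 \<le> u t"
    proof (rule eventually_above_level)
      show "(u has_real_derivative D t) (at t within {max t0 t1..})" if "max t0 t1 \<le> t" for t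
        by (rule has_field_derivative_subset[OF der]) (use that in auto)
      show "L / 2 \<le> D t" if "max t0 t1 \<le> t" for t using t1[of t] that by simp
    qed (use L in auto)
    moreover have "\<forall>\<^sub>F t in at_top. u t < l + 1" using order_tendstoD(2)[OF u] by simp
    ultimately have "\<forall>\<^sub>F t::real in at_top. False" by eventually_elim simp
    then show False by simp
  qed
  have "\<not> 0 < - L"
    by (rule not_pos[where u = "\<lambda>t. - u t" and D = "\<lambda>t. - D t" and l = "- l"])
      (use der D u in \<open>auto intro: DERIV_minus tendsto_minus\<close>)
  then show ?thesis using not_pos[OF der D u] by force
qed

text \<open>With \<open>L\<close> a one-sided Lipschitz constant at the equilibrium, \<open>(r - R) * exp ((L + 1) * t / \<tau>)\<close>
  increases whenever it returns to its initial value.\<close>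

lemma stays_above_equilibrium:
  fixes r H :: "real \<Rightarrow> real"
  assumes \<tau>: "0 < \<tau>"
    and der: "\<And>t. 0 \<le> t \<Longrightarrow> (r has_real_derivative H (r t) / \<tau>) (at t within {0..})"
    and start: "R < r 0"
    and bound: "\<And>t. 0 \<le> t \<Longrightarrow> r t \<le> r 0"
    and lip: "\<And>x. R \<le> x \<Longrightarrow> x \<le> r 0 \<Longrightarrow> - L * (x - R) \<le> H x"
    and t: "0 \<le> t"
  shows "R < r t"
proof -
  define E where "E t = exp ((L + 1) * t / \<tau>)" for t
  have dE: "(E has_real_derivative E t * ((L + 1) / \<tau>)) (at t within {0..})" for t
    unfolding E_def using \<tau> by (auto intro!: derivative_eq_intros)
  have "(r 0 - R) * E 0 \<le> (r t - R) * E t"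
  proof (rule stays_above_barrier[of 0 "\<lambda>t. (r t - R) * E t"
        "\<lambda>t. H (r t) / \<tau> * E t + E t * ((L + 1) / \<tau>) * (r t - R)", OF _ _ _ t])
    show "((\<lambda>t. (r t - R) * E t) has_real_derivative
        H (r t) / \<tau> * E t + E t * ((L + 1) / \<tau>) * (r t - R)) (at t within {0..})" if "0 \<le> t" for t
      by (rule DERIV_mult[OF _ dE, THEN DERIV_cong]) (use der[OF that] in \<open>auto intro!: derivative_eq_intros\<close>)
    fix t :: real assume t: "0 \<le> t" and eq: "(r t - R) * E t = (r 0 - R) * E 0"
    have E: "0 < E t" by (simp add: E_def)
    have "0 < (r t - R) * E t" using start eq by (simp add: E_def)
    then have "R < r t" using E by (simp add: zero_less_mult_iff)
    \<comment> \<open>The bound leaves at least \<open>r t - R\<close>, which is positive: the extra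
      \<open>1\<close> in the exponent makes the inequality strict.\<close>
    then have "0 < H (r t) + (L + 1) * (r t - R)"
      using lip[of "r t"] bound[OF t] by (simp add: algebra_simps)
    have distr: "(h + M * d) / \<tau> * e = h / \<tau> * e + e * (M / \<tau>) * d" for h M d e
      by (simp add: add_divide_distrib distrib_left distrib_right mult_ac)
    have "0 < (H (r t) + (L + 1) * (r t - R)) / \<tau> * E t"
      using \<open>0 < H (r t) + (L + 1) * (r t - R)\<close> \<tau> E by (intro mult_pos_pos divide_pos_pos)
    also have "\<dots> = H (r t) / \<tau> * E t + E t * ((L + 1) / \<tau>) * (r t - R)"
      by (rule distr)
    finally show "0 < H (r t) / \<tau> * E t + E t * ((L + 1) / \<tau>) * (r t - R)" .
  qed simp
  moreover have "0 < (r 0 - R) * E 0" using start by (simp add: E_def)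
  ultimately have "0 < (r t - R) * E t" by simp
  then show ?thesis by (simp add: E_def zero_less_mult_iff)
qed

subsection \<open>The bistable quintic\<close>

text \<open>A continuous injection into the reals from a path-connected set is a homeomorphism onto
  its image. No compactness enters, so this serves the half-line beyond the upper fold.\<close>

lemma continuous_on_inv_into_1d:
  fixes f :: "'a::topological_space \<Rightarrow> real"
  assumes "path_connected S" "continuous_on S f" "inj_on f S"
  shows "continuous_on (f ` S) (inv_into S f)"
proof -
  obtain g where "homeomorphism S (f ` S) f g"
    using homeomorphism_into_1d[OF assms(1,2) refl assms(3)] by blast
  then have g: "continuous_on (f ` S) g" "\<And>x. x \<in> S \<Longrightarrow> g (f x) = x"
    by (auto simp: homeomorphism_def)
  then show ?thesis
    by (subst continuous_on_cong[OF refl, of _ _ g]) (auto simp: inv_into_f_f[OF assms(3)])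
qed

text \<open>The lower bound on \<open>\<mu>\<close> is the saddle-node value, as
  \<open>mu_SN_eq\<close> shows; \<open>c\<close> and \<open>q\<close> stand for the cubic and
  quintic coefficients of the radial equation.\<close>

locale bistable_quintic =
  fixes \<mu> c q :: real
  assumes c_pos: "0 < c" and q_neg: "q < 0"
    and \<mu>_gt: "c\<^sup>2 / (4 * q) < \<mu>" and \<mu>_neg: "\<mu> < 0"
begin

section \<open>Folds and monotonicity of the quintic\<close>

definition f :: "real \<Rightarrow> real" where
  "f x = \<mu> * x + c * x ^ 3 + q * x ^ 5"

text \<open>The derivative of \<open>f\<close> is quadratic in x^2, with quarter-type discriminant
  9c^2 - 20 q \<mu> after halving the root. The squared folds below are its two zeros, written over
  the positive number \<open>- 10 * q\<close>.\<close>

definition root_disc :: real where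
  "root_disc = sqrt (9 * c\<^sup>2 - 20 * q * \<mu>)"

definition lower_fold :: real where
  "lower_fold = sqrt ((3 * c - root_disc) / (- 10 * q))"

definition upper_fold :: real where
  "upper_fold = sqrt ((3 * c + root_disc) / (- 10 * q))"

text \<open>The bound by \<open>2 * c\<close> encodes that \<open>\<mu>\<close> exceeds the
  saddle-node value, and the bound by \<open>3 * c\<close> encodes \<open>\<mu> < 0\<close>, which
  makes the lower fold real and positive.\<close>

lemma root_disc: "root_disc\<^sup>2 = 9 * c\<^sup>2 - 20 * q * \<mu>" "2 * c < root_disc" "root_disc < 3 * c"
proof -
  have "4 * (\<mu> * q) < c\<^sup>2" using \<mu>_gt q_neg by (simp add: field_simps)
  then have *: "(2 * c)\<^sup>2 < 9 * c\<^sup>2 - 20 * q * \<mu>" by simp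
  then show "root_disc\<^sup>2 = 9 * c\<^sup>2 - 20 * q * \<mu>"
    unfolding root_disc_def by (intro real_sqrt_pow2) (use zero_le_power2[of "2 * c"] in linarith)
  show "2 * c < root_disc" unfolding root_disc_def using * by (rule real_less_rsqrt)
  have "0 < \<mu> * q" using q_neg \<mu>_neg by (simp add: mult_neg_neg)
  then have "9 * c\<^sup>2 - 20 * q * \<mu> < (3 * c)\<^sup>2" by (simp add: power2_eq_square)
  then show "root_disc < 3 * c"
    unfolding root_disc_def using c_pos by (intro real_less_lsqrt) auto
qed

lemma fold_radicands_pos: "0 < (3 * c - root_disc) / (- 10 * q)" "0 < (3 * c + root_disc) / (- 10 * q)"
  using root_disc(2,3) c_pos q_neg by (intro divide_pos_pos; simp)+

lemma folds_sq:
  "lower_fold\<^sup>2 = (3 * c - root_disc) / (- 10 * q)" "upper_fold\<^sup>2 = (3 * c + root_disc) / (- 10 * q)"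
  unfolding lower_fold_def upper_fold_def
  by (rule real_sqrt_pow2[OF less_imp_le[OF fold_radicands_pos(1)]]
      real_sqrt_pow2[OF less_imp_le[OF fold_radicands_pos(2)]])+

lemma folds: "0 < lower_fold" "lower_fold < upper_fold" "0 < upper_fold"
proof -
  show "0 < lower_fold" "0 < upper_fold"
    unfolding lower_fold_def upper_fold_def using fold_radicands_pos by (simp_all only: real_sqrt_gt_zero)
  show "lower_fold < upper_fold"
    unfolding lower_fold_def upper_fold_def using root_disc(2) c_pos q_neg
    by (intro real_sqrt_less_mono divide_strict_right_mono) simp_all
qed

text \<open>Vieta's formulas for the squared folds turn the derivative into a product whose sign can
  be read off on each interval.\<close>

lemma f_deriv:
  "(f has_real_derivative 5 * q * (x\<^sup>2 - lower_fold\<^sup>2) * (x\<^sup>2 - upper_fold\<^sup>2)) (at x)"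
proof -
  have "(3 * c - root_disc) * (3 * c + root_disc) = 20 * q * \<mu>"
    using root_disc(1) by (simp add: algebra_simps power2_eq_square)
  then have p: "lower_fold\<^sup>2 * upper_fold\<^sup>2 = \<mu> / (5 * q)"
    unfolding folds_sq using q_neg by (simp add: field_simps power2_eq_square)
  have s: "lower_fold\<^sup>2 + upper_fold\<^sup>2 = - (3 * c) / (5 * q)"
    unfolding folds_sq using q_neg by (simp add: field_simps)
  have "5 * q * (x\<^sup>2 - lower_fold\<^sup>2) * (x\<^sup>2 - upper_fold\<^sup>2)
      = 5 * q * x ^ 4 - 5 * q * (lower_fold\<^sup>2 + upper_fold\<^sup>2) * x\<^sup>2 + 5 * q * (lower_fold\<^sup>2 * upper_fold\<^sup>2)"
    by (simp add: algebra_simps power2_eq_square power4_eq_xxxx)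
  also have "\<dots> = \<mu> + 3 * c * x\<^sup>2 + 5 * q * x ^ 4"
    unfolding p s using q_neg by (simp add: field_simps)
  finally have eq: "5 * q * (x\<^sup>2 - lower_fold\<^sup>2) * (x\<^sup>2 - upper_fold\<^sup>2) = \<mu> + 3 * c * x\<^sup>2 + 5 * q * x ^ 4" .
  show ?thesis
    unfolding f_def eq by (auto intro!: derivative_eq_intros)
qed

lemma f_cont: "continuous_on S f"
  unfolding f_def by (intro continuous_intros)

lemma f_deriv_above_neg:
  assumes "upper_fold < x" shows "5 * q * (x\<^sup>2 - lower_fold\<^sup>2) * (x\<^sup>2 - upper_fold\<^sup>2) < 0"
proof -
  have "lower_fold\<^sup>2 < x\<^sup>2" "upper_fold\<^sup>2 < x\<^sup>2"
    using assms folds by (intro power_strict_mono; simp)+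
  then show ?thesis using q_neg by (simp add: mult_neg_pos)
qed

lemma f_deriv_between_pos:
  assumes "lower_fold < x" "x < upper_fold"
  shows "0 < 5 * q * (x\<^sup>2 - lower_fold\<^sup>2) * (x\<^sup>2 - upper_fold\<^sup>2)"
proof -
  have "lower_fold\<^sup>2 < x\<^sup>2" "x\<^sup>2 < upper_fold\<^sup>2"
    using assms folds by (intro power_strict_mono; simp)+
  then show ?thesis using q_neg by (simp add: mult_neg_neg mult_neg_pos)
qed

lemma f_deriv_below_neg:
  assumes "0 < x" "x < lower_fold"
  shows "5 * q * (x\<^sup>2 - lower_fold\<^sup>2) * (x\<^sup>2 - upper_fold\<^sup>2) < 0"
proof -
  have "x\<^sup>2 < lower_fold\<^sup>2" "x\<^sup>2 < upper_fold\<^sup>2"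
    using assms folds by (intro power_strict_mono; simp)+
  then show ?thesis using q_neg by (simp add: mult_pos_neg mult_neg_neg)
qed

lemma f_decreasing_above: "upper_fold \<le> x \<Longrightarrow> x < y \<Longrightarrow> f y < f x"
  by (rule DERIV_neg_imp_decreasing_open[OF _ _ f_cont])
    (blast intro: f_deriv f_deriv_above_neg less_imp_le le_less_trans)+

lemma f_increasing_between: "lower_fold \<le> x \<Longrightarrow> x < y \<Longrightarrow> y \<le> upper_fold \<Longrightarrow> f x < f y"
  by (rule DERIV_pos_imp_increasing_open[OF _ _ f_cont])
    (blast intro: f_deriv f_deriv_between_pos le_less_trans less_le_trans)+

lemma f_neg_below: assumes "0 < x" "x \<le> lower_fold" shows "f x < 0"
proof -
  have "f x < f 0"
    by (rule DERIV_neg_imp_decreasing_open[OF assms(1) _ f_cont])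
      (use assms in \<open>blast intro: f_deriv f_deriv_below_neg less_le_trans\<close>)
  then show ?thesis by (simp add: f_def)
qed

text \<open>The quotient f(x)/x is quadratic in x^2 with vertex at x^2 = -c/(2q), where its value is
  \<mu> - c^2/(4q) > 0. This point lies between the folds, and \<open>f\<close> still increases from
  there to the upper fold.\<close>

lemma f_upper_fold_pos: "0 < f upper_fold"
proof -
  define x where "x = sqrt (- c / (2 * q))"
  have x2: "x\<^sup>2 = - c / (2 * q)" and x: "0 < x"
    unfolding x_def using c_pos q_neg by (auto simp: divide_pos_neg divide_nonneg_neg)
  have "lower_fold\<^sup>2 < x\<^sup>2" "x\<^sup>2 < upper_fold\<^sup>2"
    unfolding folds_sq x2 using root_disc q_neg c_pos by (auto simp: field_simps)
  then have "lower_fold < x" "x < upper_fold"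
    using folds x by (auto intro: power2_less_imp_less)
  then have "f x < f upper_fold" by (intro f_increasing_between) auto
  moreover have "f x = x * (\<mu> - c\<^sup>2 / (4 * q))"
  proof -
    have "f x = x * (\<mu> + c * x\<^sup>2 + q * (x\<^sup>2)\<^sup>2)"
      by (simp add: f_def algebra_simps power2_eq_square eval_nat_numeral)
    also have "\<dots> = x * (\<mu> - c\<^sup>2 / (4 * q))"
      unfolding x2 using q_neg by (simp add: field_simps power2_eq_square)
    finally show ?thesis .
  qed
  moreover have "0 < x * (\<mu> - c\<^sup>2 / (4 * q))" using x \<mu>_gt by simp
  ultimately show ?thesis by simp
qed

lemma f_less_upper_fold: assumes "0 \<le> x" "x \<noteq> upper_fold" shows "f x < f upper_fold"
proof -
  consider "x = 0" | "0 < x" "x \<le> lower_fold" | "lower_fold < x" "x < upper_fold" | "upper_fold < x"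
    using assms by linarith
  then show ?thesis
  proof cases
    case 1 then show ?thesis using f_upper_fold_pos by (simp add: f_def)
  next
    case 2 then show ?thesis using f_upper_fold_pos f_neg_below by fastforce
  next
    case 3 then show ?thesis by (intro f_increasing_between) auto
  next
    case 4 then show ?thesis by (intro f_decreasing_above) auto
  qed
qed

lemma f_unbounded_below: "\<exists>y>a. f y < v"
proof -
  \<comment> \<open>The last summand forces \<open>c + 1 + \<bar>v\<bar> \<le> - q * y\<close>. With
    \<open>1 \<le> y\<close> this yields a bound on \<open>c + q * y\<^sup>2\<close> below
    \<open>v\<close>, and multiplying that negative number by \<open>y ^ 3\<close> only lowers
    it.\<close>
  define y where "y = \<bar>a\<bar> + 1 + (c + 1 + \<bar>v\<bar>) / (- q)"
  have t: "0 < (c + 1 + \<bar>v\<bar>) / (- q)" using c_pos q_neg by (intro divide_pos_pos) auto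
  then have y: "1 \<le> y" "a < y" "(c + 1 + \<bar>v\<bar>) / (- q) \<le> y" by (auto simp: y_def)
  then have "c + 1 + \<bar>v\<bar> \<le> - q * y" using q_neg by (simp add: field_simps)
  also have "\<dots> \<le> - q * y\<^sup>2"
    using y q_neg by (intro mult_left_mono) (auto simp: power2_eq_square)
  finally have le: "c + q * y\<^sup>2 \<le> - 1 - \<bar>v\<bar>" by simp
  have "f y = \<mu> * y + y ^ 3 * (c + q * y\<^sup>2)"
    by (simp add: f_def algebra_simps power2_eq_square eval_nat_numeral)
  also have "\<dots> < y ^ 3 * (c + q * y\<^sup>2)" using y \<mu>_neg by (simp add: mult_neg_pos)
  also have "\<dots> \<le> 1 * (c + q * y\<^sup>2)"
    using y le by (intro mult_right_mono_neg) (auto simp: one_le_power)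
  also have "\<dots> < v" using le abs_ge_minus_self[of v] by simp
  finally show ?thesis using y(2) by blast
qed

section \<open>Inverse branches of the quintic\<close>

lemma f_image_above: "f ` {upper_fold..} = {..f upper_fold}"
proof (intro equalityI subsetI)
  show "v \<in> {..f upper_fold}" if "v \<in> f ` {upper_fold..}" for v
    using that f_decreasing_above[of upper_fold] by (force simp: le_less)
  fix v assume "v \<in> {..f upper_fold}"
  moreover obtain y where "upper_fold < y" "f y < v" using f_unbounded_below by blast
  ultimately show "v \<in> f ` {upper_fold..}"
    using IVT2'[of f y v upper_fold, OF _ _ _ f_cont] by force
qed

lemma f_inj_above: "inj_on f {upper_fold..}"
  by (rule linorder_inj_onI) (use f_decreasing_above in force)+

lemma f_inj_between: "inj_on f {lower_fold..upper_fold}"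
  by (rule linorder_inj_onI) (use f_increasing_between in force)+

lemma f_image_between: "f ` {lower_fold..upper_fold} = {f lower_fold..f upper_fold}"
proof (intro equalityI subsetI)
  show "v \<in> {f lower_fold..f upper_fold}" if "v \<in> f ` {lower_fold..upper_fold}" for v
    using that f_increasing_between[of lower_fold] f_increasing_between[of _ upper_fold]
    by (force simp: le_less)
  show "v \<in> f ` {lower_fold..upper_fold}" if "v \<in> {f lower_fold..f upper_fold}" for v
    using that IVT'[of f lower_fold v upper_fold, OF _ _ _ f_cont] folds by force
qed

text \<open>For projected input \<open>a\<close> the committed amplitude is
  \<open>upper_inv (- a)\<close>; the counterpart on the middle interval, \<open>middle_inv\<close>,
  yields the unstable amplitude.\<close>

definition upper_inv :: "real \<Rightarrow> real" where
  "upper_inv = inv_into {upper_fold..} f"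

definition middle_inv :: "real \<Rightarrow> real" where
  "middle_inv = inv_into {lower_fold..upper_fold} f"

lemma upper_inv:
  assumes "v \<le> f upper_fold"
  shows "f (upper_inv v) = v" "upper_fold \<le> upper_inv v"
  unfolding upper_inv_def using assms f_inv_into_f[of v f "{upper_fold..}"]
    inv_into_into[of v f "{upper_fold..}"] by (auto simp: f_image_above)

lemma upper_inv_f: "upper_fold \<le> x \<Longrightarrow> upper_inv (f x) = x"
  unfolding upper_inv_def by (rule inv_into_f_f[OF f_inj_above]) auto

lemma upper_inv_gt: "v < f upper_fold \<Longrightarrow> upper_fold < upper_inv v"
  using upper_inv[of v] by (cases "upper_inv v = upper_fold") auto

lemma upper_inv_cont: "continuous_on {..f upper_fold} upper_inv"
  using continuous_on_inv_into_1d[OF convex_imp_path_connected f_cont f_inj_above]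
  by (simp add: f_image_above upper_inv_def)

lemma middle_inv:
  assumes "f lower_fold \<le> v" "v \<le> f upper_fold"
  shows "f (middle_inv v) = v" "lower_fold \<le> middle_inv v" "middle_inv v \<le> upper_fold"
  unfolding middle_inv_def using assms f_inv_into_f[of v f "{lower_fold..upper_fold}"]
    inv_into_into[of v f "{lower_fold..upper_fold}"] by (auto simp: f_image_between)

lemma middle_inv_f: "lower_fold \<le> x \<Longrightarrow> x \<le> upper_fold \<Longrightarrow> middle_inv (f x) = x"
  unfolding middle_inv_def by (rule inv_into_f_f[OF f_inj_between]) auto

lemma middle_inv_cont: "continuous_on {f lower_fold..f upper_fold} middle_inv"
  using continuous_on_inv_into_1d[OF convex_imp_path_connected f_cont f_inj_between]
  by (simp add: f_image_between middle_inv_def)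

section \<open>Committed branch and saddle-node threshold\<close>

lemma deriv_forced: "deriv (\<lambda>x. f x + a) x = 5 * q * (x\<^sup>2 - lower_fold\<^sup>2) * (x\<^sup>2 - upper_fold\<^sup>2)"
  by (rule DERIV_imp_deriv) (use f_deriv in \<open>auto intro!: derivative_eq_intros\<close>)

text \<open>The derivative vanishes at the upper fold, so a committed root is not the fold and its
  value lies below the maximum. Hence a root beyond the fold exists, and maximality puts the
  committed root there too. Conversely \<open>f\<close> decreases strictly beyond the fold, so a
  root there is the largest.\<close>

lemma on_upper_branch_iff:
  "on_upper_branch (\<lambda>x. f x + a) x \<longleftrightarrow> upper_fold < x \<and> f x + a = 0"
proof
  assume *: "on_upper_branch (\<lambda>x. f x + a) x"
  then have x: "0 < x" "f x = - a" "5 * q * (x\<^sup>2 - lower_fold\<^sup>2) * (x\<^sup>2 - upper_fold\<^sup>2) < 0"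
    and max: "\<And>y. f y + a = 0 \<Longrightarrow> y \<le> x"
    by (auto simp: on_upper_branch_def deriv_forced)
  have "x \<noteq> upper_fold" using x(3) by auto
  then have "- a < f upper_fold" using f_less_upper_fold[of x] x by simp
  then have "upper_fold < upper_inv (- a)" "f (upper_inv (- a)) + a = 0"
    using upper_inv_gt upper_inv by auto
  then show "upper_fold < x \<and> f x + a = 0" using max x by force
next
  assume *: "upper_fold < x \<and> f x + a = 0"
  then have "y \<le> x" if "f y + a = 0" for y
    using f_decreasing_above[of x y] that by force
  then show "on_upper_branch (\<lambda>x. f x + a) x"
    using * folds f_deriv_above_neg by (auto simp: on_upper_branch_def deriv_forced)
qed

lemma unstable_amplitude_between:
  "lower_fold < x \<Longrightarrow> x < upper_fold \<Longrightarrow> f x + a = 0 \<Longrightarrow> unstable_amplitude (\<lambda>x. f x + a) x"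
  using folds f_deriv_between_pos by (auto simp: unstable_amplitude_def deriv_forced)

lemma upper_branch_exists:
  "0 < f upper_fold + a \<Longrightarrow> on_upper_branch (\<lambda>x. f x + a) (upper_inv (- a))"
  using upper_inv_gt[of "- a"] upper_inv[of "- a"] by (simp add: on_upper_branch_iff)

lemma no_positive_root:
  assumes "f upper_fold + a < 0" "0 \<le> x" shows "f x + a < 0"
  using f_less_upper_fold[OF assms(2)] assms by (cases "x = upper_fold") auto

text \<open>A smaller \<open>\<delta>\<close> fails because inputs just above it still leave a
  committed root; a larger one fails because inputs below it already leave no positive root. At the
  fold value the two inverse branches provide the merging pair.\<close>

lemma saddle_node_threshold_iff:
  assumes rs: "upper_fold < rs" "f rs + a = 0"
  shows "saddle_node_threshold (\<lambda>x. f x + a) rs \<delta> \<longleftrightarrow> \<delta> = f upper_fold + a"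
proof
  have shift: "(\<lambda>x. f x + a - s) = (\<lambda>x. f x + (a - s))" for s by auto
  have pos: "0 < f upper_fold + a" using f_decreasing_above[OF order_refl rs(1)] rs(2) by simp
  {
    assume *: "saddle_node_threshold (\<lambda>x. f x + a) rs \<delta>"
    have ev: "\<forall>\<^sub>F s in at_right \<delta>. \<not> (\<exists>r. on_upper_branch (\<lambda>x. f x + a - s) r)"
      and ex: "\<And>s. 0 \<le> s \<Longrightarrow> s < \<delta> \<Longrightarrow> \<exists>r. on_upper_branch (\<lambda>x. f x + a - s) r" and "0 < \<delta>"
      using * unfolding saddle_node_threshold_def by fastforce+
    have "\<delta> \<le> f upper_fold + a"
    proof (rule ccontr)
      assume "\<not> \<delta> \<le> f upper_fold + a"
      then obtain s where s: "f upper_fold + a < s" "s < \<delta>" using dense not_le by blast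
      obtain r where "upper_fold < r" "f r + (a - s) = 0"
        using ex[of s] s pos by (auto simp: shift on_upper_branch_iff)
      then show False using no_positive_root[of "a - s" r] s folds by simp
    qed
    moreover have "f upper_fold + a \<le> \<delta>"
    proof (rule ccontr)
      assume "\<not> f upper_fold + a \<le> \<delta>"
      then have lt: "\<delta> < f upper_fold + a" by simp
      obtain d where "\<delta> < d" "\<And>s. \<delta> < s \<Longrightarrow> s < d \<Longrightarrow> \<not> (\<exists>r. on_upper_branch (\<lambda>x. f x + a - s) r)"
        using ev by (auto simp: eventually_at_right_field)
      moreover obtain s where "\<delta> < s" "s < min d (f upper_fold + a)"
        using dense[of \<delta> "min d (f upper_fold + a)"] lt \<open>\<delta> < d\<close> by auto
      ultimately show False using upper_branch_exists[of "a - s"] by (auto simp: shift)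
    qed
    ultimately show "\<delta> = f upper_fold + a" by simp
  }
  assume \<delta>: "\<delta> = f upper_fold + a"
  \<comment> \<open>The midpoint of the fold values keeps the middle root strictly beyond the lower
    fold, where the derivative vanishes. The maximum with \<open>0\<close> covers evidence so strong
    or so weak that this midpoint input is negative.\<close>
  define s0 where "s0 = max 0 ((f lower_fold + f upper_fold) / 2 + a)"
  have lu: "f lower_fold < f upper_fold" using folds by (intro f_increasing_between) auto
  then have s0: "0 \<le> s0" "s0 < \<delta>" "f lower_fold + a < s0"
    using pos by (auto simp: s0_def \<delta> less_max_iff_disj)
  have "\<exists>rc ru s0. rc 0 = rs \<and> continuous_on {0..\<delta>} rc \<and>
        (\<forall>s\<in>{0..<\<delta>}. on_upper_branch (\<lambda>x. f x + a - s) (rc s)) \<and>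
        0 \<le> s0 \<and> s0 < \<delta> \<and> continuous_on {s0..\<delta>} ru \<and>
        (\<forall>s\<in>{s0..<\<delta>}. unstable_amplitude (\<lambda>x. f x + a - s) (ru s) \<and> ru s < rc s) \<and>
        rc \<delta> = ru \<delta>"
  proof (intro exI conjI ballI)
    show "upper_inv (0 - a) = rs" using upper_inv_f[of rs] rs by (simp add: eq_neg_iff_add_eq_0[symmetric])
    show "continuous_on {0..\<delta>} (\<lambda>s. upper_inv (s - a))"
      by (rule continuous_on_compose2[OF upper_inv_cont]) (auto intro!: continuous_intros simp: \<delta>)
    show "on_upper_branch (\<lambda>x. f x + a - s) (upper_inv (s - a))" if "s \<in> {0..<\<delta>}" for s
      using upper_branch_exists[of "a - s"] that by (simp add: shift \<delta>)
    show "0 \<le> s0" "s0 < \<delta>" by fact+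
    show "continuous_on {s0..\<delta>} (\<lambda>s. middle_inv (s - a))"
      by (rule continuous_on_compose2[OF middle_inv_cont])
        (use s0 in \<open>auto intro!: continuous_intros simp: \<delta>\<close>)
    fix s assume s: "s \<in> {s0..<\<delta>}"
    then have m: "f (middle_inv (s - a)) = s - a" "lower_fold \<le> middle_inv (s - a)"
      "middle_inv (s - a) \<le> upper_fold"
      using middle_inv[of "s - a"] s0 by (auto simp: \<delta>)
    moreover have "middle_inv (s - a) \<noteq> lower_fold" "middle_inv (s - a) \<noteq> upper_fold"
      using m(1) s s0 by (auto simp: \<delta>)
    ultimately have m': "lower_fold < middle_inv (s - a)" "middle_inv (s - a) < upper_fold" by auto
    then show "unstable_amplitude (\<lambda>x. f x + a - s) (middle_inv (s - a))"
      unfolding shift by (rule unstable_amplitude_between) (use m in simp)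
    show "middle_inv (s - a) < upper_inv (s - a)"
      using m' upper_inv(2)[of "s - a"] s by (auto simp: \<delta>)
  next
    \<comment> \<open>At the threshold both inverses are evaluated at \<open>f upper_fold\<close>,
      and both return the fold.\<close>
    show "upper_inv (\<delta> - a) = middle_inv (\<delta> - a)"
      using upper_inv_f[of upper_fold] middle_inv_f[of upper_fold] folds by (simp add: \<delta>)
  qed
  moreover have "\<forall>\<^sub>F s in at_right \<delta>. \<not> (\<exists>r. on_upper_branch (\<lambda>x. f x + a - s) r)"
    using eventually_at_right_less[of \<delta>]
  proof eventually_elim
    case (elim s)
    show ?case
    proof
      assume "\<exists>r. on_upper_branch (\<lambda>x. f x + a - s) r"
      then obtain r where "upper_fold < r" "f r + (a - s) = 0" by (auto simp: shift on_upper_branch_iff)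
      then show False using no_positive_root[of "a - s" r] elim folds by (simp add: \<delta>)
    qed
  qed
  ultimately show "saddle_node_threshold (\<lambda>x. f x + a) rs \<delta>"
    unfolding saddle_node_threshold_def using pos \<delta> by blast
qed

section \<open>Radial flow below and beyond the threshold\<close>

lemma upper_branch_robust:
  assumes \<tau>: "0 < \<tau>" and rs: "upper_fold < rs" "f rs + a = 0" and init: "upper_fold \<le> r 0"
    and der: "\<And>t. 0 \<le> t \<Longrightarrow> (r has_real_derivative (f (r t) + a + p t) / \<tau>) (at t within {0..})"
    and p: "\<And>t. 0 \<le> t \<Longrightarrow> 0 < f upper_fold + a + p t" and p0: "(p \<longlongrightarrow> 0) at_top"
  shows "0 \<le> t \<Longrightarrow> upper_fold \<le> r t" and "(r \<longlongrightarrow> rs) at_top"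
proof -
  \<comment> \<open>At the fold the velocity is positive by the bound on \<open>p\<close>, so the
    fold is a barrier. Along the whole path \<open>f\<close> is therefore in its decreasing
    range.\<close>
  show above: "upper_fold \<le> r t" if "0 \<le> t" for t
    by (rule stays_above_barrier[OF der _ init that]) (use p \<tau> in auto)
  have low: "\<forall>\<^sub>F t in at_top. x \<le> r t" if x: "upper_fold < x" "x < rs" for x
  proof -
    \<comment> \<open>Half of the unperturbed field at \<open>x\<close>: once \<open>p\<close>
      exceeds \<open>- k\<close>, a drift of at least \<open>k\<close> remains at and below
      \<open>x\<close>.\<close>
    define k where "k = (f x + a) / 2"
    have k: "0 < k" using f_decreasing_above[of x rs] x rs by (simp add: k_def)
    then obtain T where T: "\<And>t. T \<le> t \<Longrightarrow> - k < p t"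
      using order_tendstoD(1)[OF p0, of "- k"] by (auto simp: eventually_at_top_linorder)
    show ?thesis
    proof (rule eventually_above_level)
      show "(r has_real_derivative (f (r t) + a + p t) / \<tau>) (at t within {max 0 T..})"
        if "max 0 T \<le> t" for t
        by (rule has_field_derivative_subset[OF der]) (use that in auto)
      fix t assume t: "max 0 T \<le> t" "r t \<le> x"
      then have "f x \<le> f (r t)"
        using above[of t] f_decreasing_above[of "r t" x] by (cases "r t = x") auto
      moreover have "- k < p t" using T t by simp
      ultimately have "k \<le> f (r t) + a + p t" unfolding k_def by (simp add: field_simps)
      then show "k / \<tau> \<le> (f (r t) + a + p t) / \<tau>" using \<tau> by (intro divide_right_mono) auto
    qed (use k \<tau> in simp)
  qed
  have high: "\<forall>\<^sub>F t in at_top. r t \<le> x" if x: "rs < x" for x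
  proof -
    define k where "k = - (f x + a) / 2"
    have k: "0 < k" using f_decreasing_above[of rs x] x rs by (simp add: k_def)
    then obtain T where T: "\<And>t. T \<le> t \<Longrightarrow> p t < k"
      using order_tendstoD(2)[OF p0, of k] by (auto simp: eventually_at_top_linorder)
    show ?thesis
    proof (rule eventually_below_level)
      show "(r has_real_derivative (f (r t) + a + p t) / \<tau>) (at t within {max 0 T..})"
        if "max 0 T \<le> t" for t
        by (rule has_field_derivative_subset[OF der]) (use that in auto)
      fix t assume t: "max 0 T \<le> t" "x \<le> r t"
      then have "f (r t) \<le> f x"
        using x rs f_decreasing_above[of x "r t"] by (cases "r t = x") auto
      moreover have "p t < k" using T t by simp
      moreover have "2 * k = - (f x + a)" by (simp add: k_def)
      ultimately have "f (r t) + a + p t \<le> - k" by linarith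
      then show "(f (r t) + a + p t) / \<tau> \<le> - (k / \<tau>)"
        using \<tau> divide_right_mono[of "f (r t) + a + p t" "- k" \<tau>] by simp
    qed (use k \<tau> in simp)
  qed
  show "(r \<longlongrightarrow> rs) at_top"
  proof (rule order_tendstoI)
    fix x assume "x < rs"
    then obtain y where y: "max x upper_fold < y" "y < rs" using dense[of "max x upper_fold" rs] rs by auto
    from low[of y] y show "\<forall>\<^sub>F t in at_top. x < r t" by (auto elim: eventually_mono)
  next
    fix x assume "rs < x"
    then obtain y where y: "rs < y" "y < x" using dense by blast
    from high[of y] y show "\<forall>\<^sub>F t in at_top. r t < x" by (auto elim: eventually_mono)
  qed
qed

lemma f_lipschitz_at: "\<exists>L\<ge>0. \<forall>x\<in>{R..M}. \<bar>f x - f R\<bar> \<le> L * \<bar>x - R\<bar>"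
proof -
  \<comment> \<open>The cofactor of \<open>x - R\<close> in \<open>f x - f R\<close>; being a
    polynomial, it is bounded on the compact interval.\<close>
  define h where "h x = \<mu> + c * (x\<^sup>2 + x * R + R\<^sup>2)
      + q * (x ^ 4 + x ^ 3 * R + x\<^sup>2 * R\<^sup>2 + x * R ^ 3 + R ^ 4)" for x
  have h: "f x - f R = h x * (x - R)" for x
    unfolding f_def h_def by (simp add: algebra_simps eval_nat_numeral)
  have "compact (h ` {R..M})"
    unfolding h_def by (intro compact_continuous_image continuous_intros) auto
  then have "bounded (h ` {R..M})" by (rule compact_imp_bounded)
  then obtain L where L: "0 < L" "\<And>x. x \<in> {R..M} \<Longrightarrow> \<bar>h x\<bar> \<le> L"
    by (auto simp: bounded_pos)
  show ?thesis
    by (rule exI[of _ L]) (use L in \<open>auto simp: h abs_mult intro!: mult_right_mono\<close>)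
qed

text \<open>By oddness \<open>f\<close> is unbounded above on the negative axis, while the field is
  negative from \<open>0\<close> on. So negative roots exist, and compactness selects the
  largest.\<close>

lemma largest_root_after_fold:
  assumes a: "f upper_fold + a < 0"
  shows "\<exists>R<0. f R + a = 0 \<and> (\<forall>x>R. f x + a < 0)"
proof -
  have neg: "f x + a < 0" if "0 \<le> x" for x using no_positive_root[OF a that] .
  obtain y where y: "0 < y" "f y < a" using f_unbounded_below by blast
  have "f (- y) = - f y" by (simp add: f_def)
  then have y': "0 < f (- y) + a" using y by simp
  define S where "S = {- y..0} \<inter> (\<lambda>x. f x + a) -` {0}"
  have "closed S" unfolding S_def
    by (rule continuous_closed_preimage) (auto intro!: continuous_intros f_cont)
  moreover have "bounded S" unfolding S_def by (rule bounded_subset[of "{- y..0}"]) auto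
  ultimately have "compact S" by (simp add: compact_eq_bounded_closed)
  \<comment> \<open>Used twice: for the existence of a root, and to show that a nonnegative value
    right of \<open>R\<close> would produce a larger root.\<close>
  have root: "\<exists>u. x \<le> u \<and> u \<le> 0 \<and> f u + a = 0" if "x \<le> 0" "0 \<le> f x + a" for x
    using IVT2'[of f 0 "- a" x, OF _ _ _ f_cont] neg[of 0] that by force
  have "S \<noteq> {}" using root[of "- y"] y y' by (force simp: S_def)
  with \<open>compact S\<close> obtain R where R: "R \<in> S" "\<forall>u\<in>S. u \<le> R"
    using compact_attains_sup[of S] by blast
  have "f x + a < 0" if "R < x" for x
  proof (rule ccontr)
    assume nn: "\<not> f x + a < 0"
    then have "x \<le> 0" using neg[of x] by force
    with root[of x] nn obtain u where "x \<le> u" "u \<le> 0" "f u + a = 0" by auto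
    then have "u \<in> S" using that R(1) by (auto simp: S_def)
    then show False using R(2) \<open>x \<le> u\<close> that by force
  qed
  moreover have "f R + a = 0" "R \<le> 0" using R(1) by (auto simp: S_def)
  moreover from this have "R \<noteq> 0" using neg[of 0] by auto
  ultimately show ?thesis by (intro exI[of _ R]) auto
qed

text \<open>The field is negative right of \<open>R\<close>, so the amplitude never exceeds its
  initial value. The Lipschitz estimate prevents it from reaching the equilibrium \<open>R\<close>
  in finite time, and on compact intervals right of \<open>R\<close> the descent has a uniform
  rate.\<close>

lemma collapse_after_fold:
  assumes \<tau>: "0 < \<tau>" and a: "f upper_fold + a < 0" and init: "0 \<le> r 0"
    and der: "\<And>t. 0 \<le> t \<Longrightarrow> (r has_real_derivative (f (r t) + a) / \<tau>) (at t within {0..})"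
  shows "\<exists>R<0. f R + a = 0 \<and> (r \<longlongrightarrow> R) at_top"
proof -
  obtain R where R: "R < 0" "f R + a = 0" "\<And>x. R < x \<Longrightarrow> f x + a < 0"
    using largest_root_after_fold[OF a] by blast
  have le: "r t \<le> r 0" if "0 \<le> t" for t
  proof -
    have "- r 0 \<le> - r t"
    proof (rule stays_above_barrier[OF _ _ _ that])
      show "((\<lambda>t. - r t) has_real_derivative - ((f (r t) + a) / \<tau>)) (at t within {0..})" if "0 \<le> t" for t
        using der[OF that] by (rule DERIV_minus)
      show "0 < - ((f (r t) + a) / \<tau>)" if "- r t = - r 0" for t
        using R(3)[of "r t"] R(1) init that \<tau> by (simp add: divide_neg_pos)
    qed simp
    then show ?thesis by simp
  qed
  obtain L where L: "\<And>x. x \<in> {R..r 0} \<Longrightarrow> \<bar>f x - f R\<bar> \<le> L * \<bar>x - R\<bar>"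
    using f_lipschitz_at by blast
  have gt: "R < r t" if "0 \<le> t" for t
  proof (rule stays_above_equilibrium[where H = "\<lambda>x. f x + a" and L = L, OF \<tau> der _ le _ that])
    show "- L * (x - R) \<le> f x + a" if "R \<le> x" "x \<le> r 0" for x
      using L[of x] that R(2) by auto
  qed (use R init in auto)
  have high: "\<forall>\<^sub>F t in at_top. r t \<le> x" if x: "R < x" for x
  proof (cases "x \<le> r 0")
    case True
    \<comment> \<open>The point of slowest descent on the interval gives the uniform rate.\<close>
    obtain m where m: "m \<in> {x..r 0}" "\<And>y. y \<in> {x..r 0} \<Longrightarrow> f y \<le> f m"
      using continuous_attains_sup[of "{x..r 0}" f] f_cont True by auto
    have neg: "f m + a < 0" using R(3)[of m] m(1) x by simp
    show ?thesis
    proof (rule eventually_below_level[OF der])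
      show "(f (r t) + a) / \<tau> \<le> - (- ((f m + a) / \<tau>))" if "0 \<le> t" "x \<le> r t" for t
        using m(2)[of "r t"] le[of t] that \<tau> by (simp add: divide_right_mono)
      show "0 < - ((f m + a) / \<tau>)" using neg \<tau> by (simp add: divide_neg_pos)
    qed
  next
    case False
    then show ?thesis
      using le by (intro eventually_at_top_linorderI[of 0]) force
  qed
  have "(r \<longlongrightarrow> R) at_top"
  proof (rule order_tendstoI)
    show "\<forall>\<^sub>F t in at_top. x < r t" if "x < R" for x
      using gt that by (intro eventually_at_top_linorderI[of 0]) force
    fix x assume "R < x"
    then obtain y where y: "R < y" "y < x" using dense by blast
    from high[of y] y show "\<forall>\<^sub>F t in at_top. r t < x" by (auto elim: eventually_mono)
  qed
  then show ?thesis using R by blast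
qed

end

subsection \<open>Projection and the angular equation\<close>

text \<open>A geometric sum over powers of a root of unity, which differs from \<open>1\<close>
  because its half-angle lies strictly between \<open>0\<close> and \<open>pi\<close>.\<close>

lemma cis_ring_sum:
  assumes "0 < n" "n < K"
  shows "(\<Sum>j<K. cis (real n * ring_angle K j)) = 0"
proof -
  define \<omega> where "\<omega> = 2 * pi * real n / real K"
  have K: "0 < K" using assms by simp
  have "0 < \<omega> / 2" "\<omega> / 2 < pi" using assms by (auto simp: \<omega>_def field_simps)
  then have "0 < sin (\<omega> / 2)" by (rule sin_gt_zero)
  then have "cos \<omega> < 1" using cos_double_sin[of "\<omega> / 2"] by simp
  then have ne: "cis \<omega> \<noteq> 1" by (auto simp: complex_eq_iff)
  have pow: "cis (real n * ring_angle K j) = cis \<omega> ^ j" for j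
    by (simp add: Complex.DeMoivre \<omega>_def ring_angle_def mult_ac)
  have "cis \<omega> ^ K = cis (2 * pi * real n)"
    using K by (simp add: Complex.DeMoivre \<omega>_def)
  then have "cis \<omega> ^ K = 1" by simp
  then show ?thesis unfolding pow by (simp add: geometric_sum[OF ne])
qed

lemma cos_ring_sum: "0 < n \<Longrightarrow> n < K \<Longrightarrow> (\<Sum>j<K. cos (real n * ring_angle K j)) = 0"
  using arg_cong[OF cis_ring_sum[of n K], of Re] by simp

lemma sin_ring_sum: "0 < n \<Longrightarrow> n < K \<Longrightarrow> (\<Sum>j<K. sin (real n * ring_angle K j)) = 0"
  using arg_cong[OF cis_ring_sum[of n K], of Im] by simp

section \<open>Orthogonality and projection onto the critical plane\<close>

lemma ip_commute: "ip P u v = ip P v u"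
  by (simp add: ip_def mult.commute)

lemma ip_combination: "ip P (\<lambda>j. x * u j + y * v j) w = x * ip P u w + y * ip P v w"
  by (simp add: ip_def sum.distrib sum_distrib_left distrib_left distrib_right mult_ac)

lemma ip_diff: "ip P (\<lambda>j. u j - v j) w = ip P u w - ip P v w"
  by (simp add: ip_def sum_subtractf left_diff_distrib right_diff_distrib)

lemma tendsto_ip:
  assumes "\<And>j. j < dimK P \<Longrightarrow> ((\<lambda>t. u t j) \<longlongrightarrow> l j) F"
  shows "((\<lambda>t. ip P (u t) v) \<longlongrightarrow> ip P l v) F"
  unfolding ip_def by (intro tendsto_intros) (use assms in auto)

text \<open>Double-angle formulas reduce all products to ring sums of wave number
  \<open>2 * kstar P\<close>, which vanish since it lies strictly between \<open>0\<close> and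
  \<open>dimK P\<close>.\<close>

lemma critical_modes_orthogonal:
  assumes "0 < kstar P" "2 * kstar P < dimK P"
  shows "ip P (cos_mode (dimK P) (kstar P)) (cos_mode (dimK P) (kstar P)) = 1 / 2"
    and "ip P (sin_mode (dimK P) (kstar P)) (sin_mode (dimK P) (kstar P)) = 1 / 2"
    and "ip P (cos_mode (dimK P) (kstar P)) (sin_mode (dimK P) (kstar P)) = 0"
proof -
  let ?c = "\<lambda>j. cos (real (2 * kstar P) * ring_angle (dimK P) j)"
  let ?s = "\<lambda>j. sin (real (2 * kstar P) * ring_angle (dimK P) j)"
  have sums: "sum ?c {..<dimK P} = 0" "sum ?s {..<dimK P} = 0"
    using assms by (intro cos_ring_sum sin_ring_sum; simp)+
  have dbl: "real (2 * kstar P) * x = 2 * (real (kstar P) * x)" for x by simp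
  have cc: "cos_mode (dimK P) (kstar P) j * cos_mode (dimK P) (kstar P) j = (1 + ?c j) / 2" for j
    unfolding cos_mode_def dbl cos_double_cos by (simp add: power2_eq_square)
  have ss: "sin_mode (dimK P) (kstar P) j * sin_mode (dimK P) (kstar P) j = (1 - ?c j) / 2" for j
    unfolding sin_mode_def dbl cos_double_sin by (simp add: power2_eq_square)
  have cs: "cos_mode (dimK P) (kstar P) j * sin_mode (dimK P) (kstar P) j = ?s j / 2" for j
    unfolding cos_mode_def sin_mode_def dbl sin_double by simp
  have K: "real (dimK P) \<noteq> 0" using assms by simp
  show "ip P (cos_mode (dimK P) (kstar P)) (cos_mode (dimK P) (kstar P)) = 1 / 2"
    unfolding ip_def cc sum_divide_distrib[symmetric] sum.distrib sums using K by simp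
  show "ip P (sin_mode (dimK P) (kstar P)) (sin_mode (dimK P) (kstar P)) = 1 / 2"
    unfolding ip_def ss sum_divide_distrib[symmetric] sum_subtractf sums using K by simp
  show "ip P (cos_mode (dimK P) (kstar P)) (sin_mode (dimK P) (kstar P)) = 0"
    unfolding ip_def cs sum_divide_distrib[symmetric] sums by simp
qed

text \<open>The direction \<open>e_dir P \<theta>\<close> lies in the critical plane, so the
  residual of the projection is orthogonal to it. This makes the input visibly linear and continuous
  in the evidence.\<close>

lemma proj_input_eq:
  assumes k: "0 < kstar P" "2 * kstar P < dimK P"
  shows "proj_input P b \<theta> = ip P b (e_dir P \<theta>)"
proof -
  let ?C = "cos_mode (dimK P) (kstar P)" and ?S = "sin_mode (dimK P) (kstar P)"
  \<comment> \<open>The factors \<open>2\<close> compensate the squared norm 1/2 of the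
    modes.\<close>
  define p where "p j = 2 * ip P b ?C * ?C j + 2 * ip P b ?S * ?S j" for j
  note orth = critical_modes_orthogonal[OF k]
  have orth': "ip P ?S ?C = 0" using orth(3) by (simp add: ip_commute)
  have pE: "p \<in> E_c P" unfolding E_c_def p_def[abs_def] by blast
  have pp: "ip P p ?C = ip P b ?C" "ip P p ?S = ip P b ?S"
    unfolding p_def[abs_def] ip_combination by (simp_all add: orth orth')
  have perp: "ip P (\<lambda>j. b j - p j) v = 0" if vE: "v \<in> E_c P" for v
  proof -
    obtain x y where v: "v = (\<lambda>j. x * ?C j + y * ?S j)" using vE unfolding E_c_def by blast
    have "ip P (\<lambda>j. b j - p j) v = x * ip P ?C (\<lambda>j. b j - p j) + y * ip P ?S (\<lambda>j. b j - p j)"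
      unfolding v by (subst ip_commute) (rule ip_combination)
    also have "\<dots> = x * ip P (\<lambda>j. b j - p j) ?C + y * ip P (\<lambda>j. b j - p j) ?S"
      by (simp only: ip_commute)
    also have "\<dots> = 0" by (simp add: ip_diff pp)
    finally show ?thesis .
  qed
  have "Psi_A P b = p"
    unfolding Psi_A_def
  proof (rule the_equality)
    show "p \<in> E_c P \<and> (\<forall>v\<in>E_c P. ip P (\<lambda>j. b j - p j) v = 0)" using pE perp by blast
    fix p' assume p': "p' \<in> E_c P \<and> (\<forall>v\<in>E_c P. ip P (\<lambda>j. b j - p' j) v = 0)"
    then obtain x y where eq: "p' = (\<lambda>j. x * ?C j + y * ?S j)" unfolding E_c_def by blast
    have "?C \<in> E_c P" "?S \<in> E_c P"
      unfolding E_c_def by (rule CollectI, rule exI[of _ 1], rule exI[of _ 0], simp)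
        (rule CollectI, rule exI[of _ 0], rule exI[of _ 1], simp)
    then have "ip P b ?C = ip P p' ?C" "ip P b ?S = ip P p' ?S"
      using p' by (simp_all add: ip_diff)
    then have "ip P b ?C = x / 2" "ip P b ?S = y / 2"
      unfolding eq ip_combination by (simp_all add: orth orth')
    then have "x = 2 * ip P b ?C" "y = 2 * ip P b ?S" by simp_all
    then show "p' = p" unfolding eq p_def[abs_def] by simp
  qed
  moreover have "e_dir P \<theta> \<in> E_c P"
    unfolding E_c_def
    by (rule CollectI, rule exI[of _ "sqrt 2 * cos \<theta>"], rule exI[of _ "sqrt 2 * sin \<theta>"])
      (simp add: e_dir_def fun_eq_iff distrib_left mult.assoc)
  ultimately show ?thesis
    using perp[of "e_dir P \<theta>"] by (simp add: proj_input_def ip_diff)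
qed

text \<open>This removes the discontinuous \<open>Arg\<close>: the angular field becomes linear in
  the Fourier coefficients, and vanishing amplitude needs no separate case.\<close>

lemma evid_amp_sin:
  "evid_amp P b m * sin (evid_phase P b m - \<phi>) = fourier_sin P b m * cos \<phi> - fourier_cos P b m * sin \<phi>"
proof -
  let ?z = "Complex (fourier_cos P b m) (fourier_sin P b m)"
  have amp: "evid_amp P b m = cmod ?z" by (simp add: evid_amp_def cmod_def)
  have "rcis (evid_amp P b m) (evid_phase P b m) = ?z"
    unfolding amp evid_phase_def by (rule rcis_cmod_Arg)
  then have "evid_amp P b m * cos (evid_phase P b m) = fourier_cos P b m"
    "evid_amp P b m * sin (evid_phase P b m) = fourier_sin P b m"
    by (auto simp: complex_eq_iff)
  then show ?thesis by (simp add: sin_diff right_diff_distrib mult.assoc[symmetric])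
qed

lemma g_theta_fourier:
  "g_theta P b r \<theta> =
     (fourier_sin P b (kstar P) * cos \<theta> - fourier_cos P b (kstar P) * sin \<theta>) / sqrt 2
     + eta P * r\<^sup>2 / sqrt 2 *
       (3 * (fourier_sin P b (kstar P) * cos \<theta> - fourier_cos P b (kstar P) * sin \<theta>)
        + (fourier_sin P b (3 * kstar P) * cos (3 * \<theta>) - fourier_cos P b (3 * kstar P) * sin (3 * \<theta>)))"
  unfolding g_theta_def evid_amp_sin[symmetric] by (simp add: mult.assoc)

lemma tendsto_g_theta:
  fixes F :: "real filter"
  assumes "\<And>j. j < dimK P \<Longrightarrow> ((\<lambda>t. u t j) \<longlongrightarrow> b j) F" "(r \<longlongrightarrow> R) F" "(\<theta> \<longlongrightarrow> \<Theta>) F"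
  shows "((\<lambda>t. g_theta P (u t) (r t) (\<theta> t)) \<longlongrightarrow> g_theta P b R \<Theta>) F"
  unfolding g_theta_fourier fourier_cos_def fourier_sin_def
  by (intro tendsto_intros tendsto_ip assms) auto

text \<open>The wave numbers \<open>1\<close> and \<open>3\<close> of the phase are odd, so a shift by \<open>\<pi>\<close> flips the sign.\<close>

lemma g_theta_phase_of:
  assumes "g_theta P b r \<theta> = 0"
  shows "g_theta P b \<bar>r\<bar> (phase_of r \<theta>) = 0"
proof -
  have "sin (3 * (\<theta> + pi)) = - sin (3 * \<theta>)" "cos (3 * (\<theta> + pi)) = - cos (3 * \<theta>)"
    using sin_periodic[of "3 * \<theta> + pi"] cos_periodic[of "3 * \<theta> + pi"] by (simp_all add: algebra_simps)
  then have "g_theta P b \<bar>r\<bar> (\<theta> + pi) = - g_theta P b r \<theta>"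
    unfolding g_theta_fourier by (simp only: sin_periodic_pi cos_periodic_pi power2_abs) argo
  then show ?thesis using assms by (cases "0 < r") (simp_all only: phase_of_def if_True if_False abs_of_pos minus_zero)
qed

text \<open>As the amplitude has a nonzero limit, the phase equation can be solved for the phase
  velocity, which then converges. Convergence of the phase forces that limit to be zero.\<close>

lemma reduced_limit_g_theta:
  assumes \<tau>: "0 < tau_z P"
    and sol: "reduced_solution P u r \<theta>"
    and u: "\<And>j. j < dimK P \<Longrightarrow> ((\<lambda>t. u t j) \<longlongrightarrow> b j) at_top"
    and r: "(r \<longlongrightarrow> R) at_top" and \<theta>: "(\<theta> \<longlongrightarrow> \<Theta>) at_top" and R: "R \<noteq> 0"
  shows "g_theta P b R \<Theta> = 0"
proof -
  \<comment> \<open>The time restriction sits inside the existential so that choice gives one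
    velocity function on all of the reals.\<close>
  have "\<forall>t. \<exists>D. 0 \<le> t \<longrightarrow> (\<theta> has_real_derivative D) (at t within {0..}) \<and>
      tau_z P * r t * D = g_theta P (u t) (r t) (\<theta> t)"
    using sol unfolding reduced_solution_def by blast
  then obtain D where D: "\<And>t. 0 \<le> t \<Longrightarrow> (\<theta> has_real_derivative D t) (at t within {0..})"
    "\<And>t. 0 \<le> t \<Longrightarrow> tau_z P * r t * D t = g_theta P (u t) (r t) (\<theta> t)"
    by metis
  have "((\<lambda>t. g_theta P (u t) (r t) (\<theta> t) / (tau_z P * r t)) \<longlongrightarrow> g_theta P b R \<Theta> / (tau_z P * R)) at_top"
    by (intro tendsto_intros tendsto_g_theta u r \<theta>) (use \<tau> R in auto)
  moreover have "\<forall>\<^sub>F t in at_top. g_theta P (u t) (r t) (\<theta> t) / (tau_z P * r t) = D t"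
    using tendsto_imp_eventually_ne[OF r R] eventually_ge_at_top[of 0]
  proof eventually_elim
    case (elim t)
    then show ?case using D(2)[of t] \<tau> by (simp add: field_simps)
  qed
  ultimately have "(D \<longlongrightarrow> g_theta P b R \<Theta> / (tau_z P * R)) at_top"
    using Lim_transform_eventually by blast
  from deriv_limit_zero[OF D(1) this \<theta>] show ?thesis using \<tau> R by simp
qed

text \<open>A maximum over finitely many entries is attained, so the \<open>LEAST\<close> in the
  selection is a genuine index.\<close>

lemma selected_action_less: assumes "0 < dimK P" shows "selected_action P \<theta> < dimK P"
proof -
  have "\<exists>j<dimK P. \<forall>i<dimK P. e_dir P \<theta> i \<le> e_dir P \<theta> j"
  proof -
    have "Max (e_dir P \<theta> ` {..<dimK P}) \<in> e_dir P \<theta> ` {..<dimK P}"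
      using assms by (intro Max_in) auto
    then obtain j where "j < dimK P" "e_dir P \<theta> j = Max (e_dir P \<theta> ` {..<dimK P})" by auto
    then show ?thesis by (auto intro!: exI[of _ j])
  qed
  from LeastI_ex[OF this] show ?thesis by (simp add: selected_action_def)
qed

text \<open>A common solution is a double root of the quadratic in r^2. Subtracting the two
  conditions forces r^2 = -c/(2q), which determines \<mu>; the same radius shows that this value is
  attained, as the definite description requires.\<close>

lemma mu_SN_eq:
  assumes c: "0 < cubic P" and q: "quintic P < 0"
  shows "mu_SN P = (cubic P)\<^sup>2 / (4 * quintic P)"
proof -
  let ?c = "cubic P" and ?q = "quintic P"
  have deriv: "deriv (unforced_radial P \<mu>) r = \<mu> + 3 * ?c * r\<^sup>2 + 5 * ?q * r ^ 4" for \<mu> r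
    by (rule DERIV_imp_deriv) (auto simp: unforced_radial_def[abs_def] intro!: derivative_eq_intros)
  have fac: "unforced_radial P \<mu> r = r * (\<mu> + ?c * r\<^sup>2 + ?q * (r\<^sup>2)\<^sup>2)" for \<mu> r
    by (simp add: unforced_radial_def algebra_simps eval_nat_numeral)
  have r4: "r ^ 4 = (r\<^sup>2)\<^sup>2" for r :: real by simp
  show ?thesis
    unfolding mu_SN_def
  proof (rule the_equality)
    define r where "r = sqrt (- ?c / (2 * ?q))"
    have pos: "0 < - ?c / (2 * ?q)" using c q by (intro divide_neg_neg) auto
    then have r: "0 < r" "r\<^sup>2 = - ?c / (2 * ?q)" by (simp_all add: r_def)
    have "?q * r\<^sup>2 = - ?c / 2" unfolding r(2) using q by simp
    then have "?q * (r\<^sup>2)\<^sup>2 = - (?c * r\<^sup>2) / 2"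
      by (simp only: power2_eq_square[of "r\<^sup>2"] mult.assoc[symmetric])
    moreover have "?c\<^sup>2 / (4 * ?q) = - (?c * r\<^sup>2) / 2"
      unfolding r(2) by (simp add: power2_eq_square)
    ultimately have "?c\<^sup>2 / (4 * ?q) + ?c * r\<^sup>2 + ?q * (r\<^sup>2)\<^sup>2 = 0"
      "?c\<^sup>2 / (4 * ?q) + 3 * ?c * r\<^sup>2 + 5 * ?q * (r\<^sup>2)\<^sup>2 = 0"
      by (simp_all add: mult.assoc)
    then show "\<exists>r>0. unforced_radial P (?c\<^sup>2 / (4 * ?q)) r = 0 \<and>
        deriv (unforced_radial P (?c\<^sup>2 / (4 * ?q))) r = 0"
      unfolding fac deriv r4 by (intro exI[of _ r] conjI r(1)) (simp_all only: mult_zero_right)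
  next
    fix \<mu> assume "\<exists>r>0. unforced_radial P \<mu> r = 0 \<and> deriv (unforced_radial P \<mu>) r = 0"
    then obtain r where r: "0 < r" and "r * (\<mu> + ?c * r\<^sup>2 + ?q * (r\<^sup>2)\<^sup>2) = 0"
      and eq2: "\<mu> + 3 * ?c * r\<^sup>2 + 5 * ?q * (r\<^sup>2)\<^sup>2 = 0"
      unfolding fac deriv r4 by blast
    then have eq1: "\<mu> + ?c * r\<^sup>2 + ?q * (r\<^sup>2)\<^sup>2 = 0" by simp
    have "2 * r\<^sup>2 * (?c + 2 * ?q * r\<^sup>2)
        = (\<mu> + 3 * ?c * r\<^sup>2 + 5 * ?q * (r\<^sup>2)\<^sup>2) - (\<mu> + ?c * r\<^sup>2 + ?q * (r\<^sup>2)\<^sup>2)"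
      by (simp add: algebra_simps power2_eq_square)
    then have "?c + 2 * ?q * r\<^sup>2 = 0" unfolding eq1 eq2 using r by simp
    then have "r\<^sup>2 * (2 * ?q) = - ?c" by (simp add: mult.commute)
    then have x: "r\<^sup>2 = - ?c / (2 * ?q)" by (intro eq_divide_imp) (use q in simp_all)
    have "\<mu> = - (?c * r\<^sup>2) - ?q * (r\<^sup>2)\<^sup>2" using eq1 by simp
    also have "\<dots> = ?c\<^sup>2 / (4 * ?q)" unfolding x using q by (simp add: field_simps power2_eq_square)
    finally show "\<mu> = ?c\<^sup>2 / (4 * ?q)" .
  qed
qed

subsection \<open>Robustness of commitment\<close>

theorem proposition3:
  fixes P :: decision_system and b :: "nat \<Rightarrow> real" and rs \<theta>0 :: real
  assumes "standing_assumptions P"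
    and "cubic P > 0" and "quintic P < 0"
    and "mu_SN P < mu0 P" and "mu0 P < 0"
    and "committed_equilibrium P b rs \<theta>0" and "locally_stable P b rs \<theta>0"
  shows
    "(\<exists>\<delta>s>0.
        (\<exists>\<rho>. \<rho> 0 = rs \<and> continuous_on {- \<delta>s<..} \<rho> \<and>
             (\<forall>p>- \<delta>s. on_upper_branch (\<lambda>r. g_r P b r \<theta>0 + p) (\<rho> p))) \<and>
        (\<exists>rmin>0. \<forall>\<delta>b :: real \<Rightarrow> nat \<Rightarrow> real.
           (\<forall>j<dimK P. ((\<lambda>t. \<delta>b t j) \<longlongrightarrow> 0) at_top) \<and>
           (\<forall>t\<ge>0. proj_input P (\<delta>b t) \<theta>0 < 0 \<longrightarrow> \<bar>proj_input P (\<delta>b t) \<theta>0\<bar> < \<delta>s) \<longrightarrow>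
           (\<forall>t\<ge>0. \<exists>r\<ge>rmin. on_upper_branch (\<lambda>r. g_r P b r \<theta>0 + proj_input P (\<delta>b t) \<theta>0) r) \<and>
           (\<forall>r. radial_solution P (\<lambda>t r. g_r P b r \<theta>0 + proj_input P (\<delta>b t) \<theta>0) r \<and> r 0 = rs \<longrightarrow>
              (\<forall>t\<ge>0. r t \<ge> rmin) \<and> (r \<longlongrightarrow> rs) at_top)))
     \<and>
     (\<exists>!\<delta>SN. saddle_node_threshold (\<lambda>r. g_r P b r \<theta>0) rs \<delta>SN) \<and>
     (\<forall>\<delta>SN. saddle_node_threshold (\<lambda>r. g_r P b r \<theta>0) rs \<delta>SN \<longrightarrow>
        (\<exists>J>0. \<forall>\<delta>b :: nat \<Rightarrow> real.
           proj_input P \<delta>b \<theta>0 < 0 \<and> \<bar>proj_input P \<delta>b \<theta>0\<bar> > \<delta>SN \<longrightarrow>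
           \<not> (\<exists>r>0. g_r P b r \<theta>0 + proj_input P \<delta>b \<theta>0 = 0) \<and>
           (\<forall>r s. radial_solution P (\<lambda>_ r. g_r P b r \<theta>0 + proj_input P \<delta>b \<theta>0) r \<and>
                  s \<in> {0..<\<delta>SN} \<and> on_upper_branch (\<lambda>r. g_r P b r \<theta>0 - s) (r 0) \<longrightarrow>
              (\<exists>rinf. (r \<longlongrightarrow> rinf) at_top \<and> g_r P b rinf \<theta>0 + proj_input P \<delta>b \<theta>0 = 0 \<and>
                      \<bar>r 0 - rinf\<bar> \<ge> J))))
     \<and>
     (\<forall>(\<delta>b :: real \<Rightarrow> nat \<Rightarrow> real) \<delta>binf r \<theta> rinf \<theta>inf.
        (\<forall>j<dimK P. ((\<lambda>t. \<delta>b t j) \<longlongrightarrow> \<delta>binf j) at_top) \<and>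
        reduced_solution P (\<lambda>t j. b j + \<delta>b t j) r \<theta> \<and> r 0 = rs \<and> \<theta> 0 = \<theta>0 \<and>
        (r \<longlongrightarrow> rinf) at_top \<and> (\<theta> \<longlongrightarrow> \<theta>inf) at_top \<and> rinf \<noteq> 0 \<longrightarrow>
        (phase_of rinf \<theta>inf \<in> action_sector P (selected_action P \<theta>0) \<longrightarrow>
           selected_action P (phase_of rinf \<theta>inf) = selected_action P \<theta>0) \<and>
        (phase_of rinf \<theta>inf \<notin> action_sector P (selected_action P \<theta>0) \<longrightarrow>
           g_theta P (\<lambda>j. b j + \<delta>binf j) \<bar>rinf\<bar> (phase_of rinf \<theta>inf) = 0 \<and>
           selected_action P (phase_of rinf \<theta>inf) < dimK P \<and>
           selected_action P (phase_of rinf \<theta>inf) \<noteq> selected_action P \<theta>0))"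
proof (intro conjI)
  note SA = assms(1)[unfolded standing_assumptions_def]
  from SA have \<tau>: "0 < tau_z P" and k: "0 < kstar P" "2 * kstar P < dimK P" by auto
  \<comment> \<open>Here \<open>mu_SN_eq\<close> converts the saddle-node hypothesis into the
    explicit lower bound of the locale.\<close>
  interpret Q: bistable_quintic "mu0 P" "cubic P" "quintic P"
    by unfold_locales (use assms(2-5) mu_SN_eq[OF assms(2,3)] in auto)
  define a where "a = proj_input P b \<theta>0"
  define m where "m = Q.upper_fold"
  have g_r: "g_r P b r \<theta>0 = Q.f r + a" for r
    by (simp add: g_r_def unforced_radial_def Q.f_def a_def)
  have shift: "(\<lambda>r. Q.f r + a + p) = (\<lambda>r. Q.f r + (a + p))"
    "(\<lambda>r. Q.f r + a - p) = (\<lambda>r. Q.f r + (a - p))" for p by auto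
  have rs: "m < rs" "Q.f rs + a = 0"
    using assms(6) unfolding committed_equilibrium_def g_r Q.on_upper_branch_iff m_def by auto
  have pos: "0 < Q.f m + a"
    using Q.f_decreasing_above[of m rs] rs by (simp add: m_def)
  have m: "0 < m" using Q.folds by (simp add: m_def)
  have threshold: "saddle_node_threshold (\<lambda>r. Q.f r + a) rs \<delta> \<longleftrightarrow> \<delta> = Q.f m + a" for \<delta>
    using Q.saddle_node_threshold_iff[of rs a \<delta>] rs by (simp add: m_def)

  \<comment> \<open>Persistence below the threshold\<close>
  have branch: "on_upper_branch (\<lambda>r. Q.f r + a + p) (Q.upper_inv (- a - p))" if "- (Q.f m + a) < p" for p
    using Q.upper_branch_exists[of "a + p"] that by (simp add: shift m_def)
  show "\<exists>\<delta>s>0.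
        (\<exists>\<rho>. \<rho> 0 = rs \<and> continuous_on {- \<delta>s<..} \<rho> \<and>
             (\<forall>p>- \<delta>s. on_upper_branch (\<lambda>r. g_r P b r \<theta>0 + p) (\<rho> p))) \<and>
        (\<exists>rmin>0. \<forall>\<delta>b :: real \<Rightarrow> nat \<Rightarrow> real.
           (\<forall>j<dimK P. ((\<lambda>t. \<delta>b t j) \<longlongrightarrow> 0) at_top) \<and>
           (\<forall>t\<ge>0. proj_input P (\<delta>b t) \<theta>0 < 0 \<longrightarrow> \<bar>proj_input P (\<delta>b t) \<theta>0\<bar> < \<delta>s) \<longrightarrow>
           (\<forall>t\<ge>0. \<exists>r\<ge>rmin. on_upper_branch (\<lambda>r. g_r P b r \<theta>0 + proj_input P (\<delta>b t) \<theta>0) r) \<and>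
           (\<forall>r. radial_solution P (\<lambda>t r. g_r P b r \<theta>0 + proj_input P (\<delta>b t) \<theta>0) r \<and> r 0 = rs \<longrightarrow>
              (\<forall>t\<ge>0. r t \<ge> rmin) \<and> (r \<longlongrightarrow> rs) at_top))"
    unfolding g_r
  \<comment> \<open>The radius chosen is the field at the upper fold, the same number that
    \<open>threshold\<close> identifies as the saddle-node threshold.\<close>
  proof (rule exI[of _ "Q.f m + a"], intro conjI pos, rule exI[of _ "\<lambda>p. Q.upper_inv (- a - p)"],
      intro conjI allI impI, goal_cases start cont upper persist)
    case start
    show ?case
      using Q.upper_inv_f[of rs] rs by (simp add: m_def eq_neg_iff_add_eq_0[symmetric])
  next
    case cont
    show ?case
      by (rule continuous_on_compose2[OF Q.upper_inv_cont]) (auto intro!: continuous_intros simp: m_def)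
  next
    case (upper p)
    then show ?case by (rule branch)
  next
    case persist
    show ?case
    proof (rule exI[of _ m], intro conjI m allI impI; elim conjE)
      fix \<delta>b :: "real \<Rightarrow> nat \<Rightarrow> real"
      let ?p = "\<lambda>t. proj_input P (\<delta>b t) \<theta>0"
      assume lim: "\<forall>j<dimK P. ((\<lambda>t. \<delta>b t j) \<longlongrightarrow> 0) at_top"
        and small: "\<forall>t\<ge>0. ?p t < 0 \<longrightarrow> \<bar>?p t\<bar> < Q.f m + a"
      \<comment> \<open>The smallness hypothesis restricts negative projections; for the others the
        bound follows from \<open>pos\<close>.\<close>
      have p: "- (Q.f m + a) < ?p t" if "0 \<le> t" for t
        using small[rule_format, OF that] pos by linarith
      have "(?p \<longlongrightarrow> ip P (\<lambda>_. 0) (e_dir P \<theta>0)) at_top"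
        unfolding proj_input_eq[OF k] by (rule tendsto_ip) (use lim in auto)
      then have p0: "(?p \<longlongrightarrow> 0) at_top" by (simp add: ip_def)
      show "\<exists>r\<ge>m. on_upper_branch (\<lambda>r. Q.f r + a + ?p t) r" if "0 \<le> t" for t
        using branch[OF p[OF that]] unfolding shift Q.on_upper_branch_iff m_def by (meson less_imp_le)
      fix r :: "real \<Rightarrow> real"
      assume "radial_solution P (\<lambda>t r. Q.f r + a + ?p t) r" and "r 0 = rs"
      then have der: "\<And>t. 0 \<le> t \<Longrightarrow>
          (r has_real_derivative (Q.f (r t) + a + ?p t) / tau_z P) (at t within {0..})"
        and init: "Q.upper_fold \<le> r 0"
        using rs by (auto simp: radial_solution_def m_def)
      have pos': "0 < Q.f Q.upper_fold + a + ?p t" if "0 \<le> t" for t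
        using p[OF that] by (simp add: m_def)
      note robust = Q.upper_branch_robust[where r = r and p = ?p, OF \<tau> rs[unfolded m_def] init der pos' p0]
      show "m \<le> r t" if "0 \<le> t" for t using robust(1) that by (simp add: m_def)
      show "(r \<longlongrightarrow> rs) at_top" by (rule robust(2))
    qed
  qed

  \<comment> \<open>Threshold and loss of commitment\<close>
  show "\<exists>!\<delta>SN. saddle_node_threshold (\<lambda>r. g_r P b r \<theta>0) rs \<delta>SN"
    unfolding g_r threshold by simp

  show "\<forall>\<delta>SN. saddle_node_threshold (\<lambda>r. g_r P b r \<theta>0) rs \<delta>SN \<longrightarrow>
        (\<exists>J>0. \<forall>\<delta>b :: nat \<Rightarrow> real.
           proj_input P \<delta>b \<theta>0 < 0 \<and> \<bar>proj_input P \<delta>b \<theta>0\<bar> > \<delta>SN \<longrightarrow>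
           \<not> (\<exists>r>0. g_r P b r \<theta>0 + proj_input P \<delta>b \<theta>0 = 0) \<and>
           (\<forall>r s. radial_solution P (\<lambda>_ r. g_r P b r \<theta>0 + proj_input P \<delta>b \<theta>0) r \<and>
                  s \<in> {0..<\<delta>SN} \<and> on_upper_branch (\<lambda>r. g_r P b r \<theta>0 - s) (r 0) \<longrightarrow>
              (\<exists>rinf. (r \<longlongrightarrow> rinf) at_top \<and> g_r P b rinf \<theta>0 + proj_input P \<delta>b \<theta>0 = 0 \<and>
                      \<bar>r 0 - rinf\<bar> \<ge> J)))"
    unfolding g_r threshold
  \<comment> \<open>The jump size is the upper fold \<open>m\<close>: paths start beyond it and end
    at a negative amplitude.\<close>
  proof (intro allI impI, rule exI[of _ m], intro conjI m allI impI; elim conjE)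
    fix \<delta>SN and \<delta>b :: "nat \<Rightarrow> real"
    let ?p = "proj_input P \<delta>b \<theta>0"
    assume "\<delta>SN = Q.f m + a" "?p < 0" "\<bar>?p\<bar> > \<delta>SN"
    then have over: "Q.f Q.upper_fold + (a + ?p) < 0" by (simp add: m_def)
    show "\<not> (\<exists>r>0. Q.f r + a + ?p = 0)"
    proof
      assume "\<exists>r>0. Q.f r + a + ?p = 0"
      then obtain r where "0 < r" "Q.f r + a + ?p = 0" by blast
      then show False using Q.no_positive_root[OF over, of r] by simp
    qed
    fix r :: "real \<Rightarrow> real" and s
    assume sol: "radial_solution P (\<lambda>_ r. Q.f r + a + ?p) r"
      and "on_upper_branch (\<lambda>r. Q.f r + a - s) (r 0)"
    then have init: "m < r 0" unfolding shift Q.on_upper_branch_iff m_def by simp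
    have der: "(r has_real_derivative (Q.f (r t) + (a + ?p)) / tau_z P) (at t within {0..})"
      if "0 \<le> t" for t
      using sol that by (simp add: radial_solution_def add.assoc)
    obtain R where R: "R < 0" "Q.f R + (a + ?p) = 0" "(r \<longlongrightarrow> R) at_top"
      using Q.collapse_after_fold[OF \<tau> over _ der] init m by auto
    then show "\<exists>rinf. (r \<longlongrightarrow> rinf) at_top \<and> Q.f rinf + a + ?p = 0 \<and> m \<le> \<bar>r 0 - rinf\<bar>"
      using init by (intro exI[of _ R]) auto
  qed

  \<comment> \<open>Limiting phase and selected action\<close>
  show "\<forall>(\<delta>b :: real \<Rightarrow> nat \<Rightarrow> real) \<delta>binf r \<theta> rinf \<theta>inf.
        (\<forall>j<dimK P. ((\<lambda>t. \<delta>b t j) \<longlongrightarrow> \<delta>binf j) at_top) \<and>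
        reduced_solution P (\<lambda>t j. b j + \<delta>b t j) r \<theta> \<and> r 0 = rs \<and> \<theta> 0 = \<theta>0 \<and>
        (r \<longlongrightarrow> rinf) at_top \<and> (\<theta> \<longlongrightarrow> \<theta>inf) at_top \<and> rinf \<noteq> 0 \<longrightarrow>
        (phase_of rinf \<theta>inf \<in> action_sector P (selected_action P \<theta>0) \<longrightarrow>
           selected_action P (phase_of rinf \<theta>inf) = selected_action P \<theta>0) \<and>
        (phase_of rinf \<theta>inf \<notin> action_sector P (selected_action P \<theta>0) \<longrightarrow>
           g_theta P (\<lambda>j. b j + \<delta>binf j) \<bar>rinf\<bar> (phase_of rinf \<theta>inf) = 0 \<and>
           selected_action P (phase_of rinf \<theta>inf) < dimK P \<and>
           selected_action P (phase_of rinf \<theta>inf) \<noteq> selected_action P \<theta>0)"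
  proof (intro allI impI; elim conjE)
    fix \<delta>b :: "real \<Rightarrow> nat \<Rightarrow> real" and \<delta>binf r \<theta> rinf \<theta>inf
    assume lim: "\<forall>j<dimK P. ((\<lambda>t. \<delta>b t j) \<longlongrightarrow> \<delta>binf j) at_top"
      and sol: "reduced_solution P (\<lambda>t j. b j + \<delta>b t j) r \<theta>"
      and r: "(r \<longlongrightarrow> rinf) at_top" and \<theta>: "(\<theta> \<longlongrightarrow> \<theta>inf) at_top" and "rinf \<noteq> 0"
    have "g_theta P (\<lambda>j. b j + \<delta>binf j) rinf \<theta>inf = 0"
      by (rule reduced_limit_g_theta[OF \<tau> sol _ r \<theta> \<open>rinf \<noteq> 0\<close>])
        (use lim in \<open>auto intro!: tendsto_intros\<close>)
    then show "(phase_of rinf \<theta>inf \<in> action_sector P (selected_action P \<theta>0) \<longrightarrow>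
           selected_action P (phase_of rinf \<theta>inf) = selected_action P \<theta>0) \<and>
        (phase_of rinf \<theta>inf \<notin> action_sector P (selected_action P \<theta>0) \<longrightarrow>
           g_theta P (\<lambda>j. b j + \<delta>binf j) \<bar>rinf\<bar> (phase_of rinf \<theta>inf) = 0 \<and>
           selected_action P (phase_of rinf \<theta>inf) < dimK P \<and>
           selected_action P (phase_of rinf \<theta>inf) \<noteq> selected_action P \<theta>0)"
      \<comment> \<open>A negative limiting amplitude is rewritten with the opposite phase;
        \<open>g_theta_phase_of\<close> carries the angular equation to that representative.\<close>
      using g_theta_phase_of selected_action_less k by (simp add: action_sector_def)
  qed
qed

end
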